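(* Let $G$ be a finite simple graph on the vertex set $\{v_1,\ldots,v_n\}$, let $A_G$ be its vertex-edge incidence matrix, let $E_n$ be the $n\times n$ identity matrix, and let $\overline{A_G}=(\,2E_n\mid A_G\,)$. Let $K$ be a field. Then the following conditions are equivalent: (i) $G$ is strongly chordal; (ii) the toric ideal $I_{\overline{A_G}}$ has a quadratic Gröbner basis; (iii) the toric ideal $I_{\overline{A_G}}$ is generated by quadratic binomials.
   Context: The vertex-edge incidence matrix $A_G$ is the $n\times|E(G)|$ matrix whose column for the edge $\{v_i,v_j\}$ is $\mathbf{e}_i+\mathbf{e}_j$. For an integer matrix $A=(\mathbf{a}_1,\ldots,\mathbf{a}_m)$ the toric ideal $I_A\subset K[y_1,\ldots,y_m]$ is generated by all binomials $\prod_{b_i>0}y_i^{b_i}-\prod_{b_j<0}y_j^{-b_j}$ with $\mathbf{b}\in\mathbb{Z}^m$, $A\mathbf{b}=\mathbf{0}$. A vertex $v$ is simplicial in a graph if its neighbours form a clique. An ordering $v_1,\ldots,v_n$ of the vertices is a perfect elimination ordering if for each $i<n$, $v_i$ is simplicial in the induced subgraph on $v_i,\ldots,v_n$; it is a strong perfect elimination ordering if in addition, whenever $i<j<k<\ell$ and $\{v_i,v_k\},\{v_i,v_\ell\},\{v_j,v_k\}\in E(G)$, then $\{v_j,v_\ell\}\in E(G)$. $G$ is strongly chordal if it has a strong perfect elimination ordering. "Has a quadratic Gröbner basis" means there is a monomial order with respect to which the ideal has a Gröbner basis consisting of binomials of degree $2$. *)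

theory Defs
  imports
    "HOL-Library.Poly_Mapping"
    "HOL-Algebra.Ideal"
    "Jordan_Normal_Form.Matrix"
begin

definition simple_graph :: "'v set \<Rightarrow> 'v set set \<Rightarrow> bool" where
  "simple_graph V E \<longleftrightarrow> finite V \<and> (\<forall>e\<in>E. e \<subseteq> V \<and> card e = 2)"

definition induced_edges :: "'v set set \<Rightarrow> 'v set \<Rightarrow> 'v set set" where
  "induced_edges E W = {e \<in> E. e \<subseteq> W}"

definition neighbours :: "'v set set \<Rightarrow> 'v \<Rightarrow> 'v set" where
  "neighbours E v = {u. {v, u} \<in> E}"

definition is_clique :: "'v set set \<Rightarrow> 'v set \<Rightarrow> bool" where
  "is_clique E S \<longleftrightarrow> (\<forall>u\<in>S. \<forall>w\<in>S. u \<noteq> w \<longrightarrow> {u, w} \<in> E)"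

definition simplicial :: "'v set set \<Rightarrow> 'v \<Rightarrow> bool" where
  "simplicial E v \<longleftrightarrow> is_clique E (neighbours E v)"

text \<open>Orderings of the vertices are lists, so positions are counted from 0.\<close>

definition perfect_elimination_ordering ::
    "'v set \<Rightarrow> 'v set set \<Rightarrow> 'v list \<Rightarrow> bool" where
  "perfect_elimination_ordering V E vs \<longleftrightarrow>
     distinct vs \<and> set vs = V \<and>
     (\<forall>i. Suc i < length vs \<longrightarrow>
        simplicial (induced_edges E (set (drop i vs))) (vs ! i))"

definition strong_perfect_elimination_ordering ::
    "'v set \<Rightarrow> 'v set set \<Rightarrow> 'v list \<Rightarrow> bool" where
  "strong_perfect_elimination_ordering V E vs \<longleftrightarrow>
     perfect_elimination_ordering V E vs \<and>
     (\<forall>i j k l. i < j \<and> j < k \<and> k < l \<and> l < length vs \<and>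
        {vs ! i, vs ! k} \<in> E \<and> {vs ! i, vs ! l} \<in> E \<and> {vs ! j, vs ! k} \<in> E
        \<longrightarrow> {vs ! j, vs ! l} \<in> E)"

definition strongly_chordal :: "'v set \<Rightarrow> 'v set set \<Rightarrow> bool" where
  "strongly_chordal V E \<longleftrightarrow> (\<exists>vs. strong_perfect_elimination_ordering V E vs)"

text \<open>The lists \<open>vs\<close> and \<open>es\<close> fix the order of the rows (vertices) and of the
  columns (edges).\<close>

definition incidence_matrix :: "'v list \<Rightarrow> 'v set list \<Rightarrow> int mat" where
  "incidence_matrix vs es =
     mat (length vs) (length es) (\<lambda>(i, j). if vs ! i \<in> es ! j then 1 else 0)"

definition extended_incidence_matrix :: "'v list \<Rightarrow> 'v set list \<Rightarrow> int mat" where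
  "extended_incidence_matrix vs es =
     mat_of_cols (length vs)
       (cols (2 \<cdot>\<^sub>m 1\<^sub>m (length vs)) @ cols (incidence_matrix vs es))"

text \<open>The type \<open>'k mpoly_nat\<close> has infinitely many variables \<open>y\<^sub>0, y\<^sub>1, \<dots>\<close>; the ring in
  the first \<open>m\<close> of them is a subring, given as a structure with carrier.\<close>

type_synonym monom_nat = "nat \<Rightarrow>\<^sub>0 nat"
type_synonym 'k mpoly_nat = "monom_nat \<Rightarrow>\<^sub>0 'k"

definition monomials :: "nat \<Rightarrow> monom_nat set" where
  "monomials m = {t. Poly_Mapping.keys t \<subseteq> {..<m}}"

definition poly_ring :: "nat \<Rightarrow> ('k::field) mpoly_nat ring" where
  "poly_ring m =
     \<lparr>carrier = {p. Poly_Mapping.keys p \<subseteq> monomials m},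
      monoid.mult = (*), one = 1, zero = 0, add = (+)\<rparr>"

definition mpoly_var :: "nat \<Rightarrow> ('k::field) mpoly_nat" where
  "mpoly_var i = Poly_Mapping.single (Poly_Mapping.single i 1) 1"

definition mpoly_monom :: "monom_nat \<Rightarrow> ('k::field) mpoly_nat" where
  "mpoly_monom t = Poly_Mapping.single t 1"

definition monom_degree :: "monom_nat \<Rightarrow> nat" where
  "monom_degree t = (\<Sum>i\<in>Poly_Mapping.keys t. Poly_Mapping.lookup t i)"

text \<open>Only meaningful for nonzero polynomials.\<close>

definition total_degree :: "('k::field) mpoly_nat \<Rightarrow> nat" where
  "total_degree p = Max (monom_degree ` Poly_Mapping.keys p)"

definition quadratic_binomial :: "('k::field) mpoly_nat \<Rightarrow> bool" where
  "quadratic_binomial p \<longleftrightarrow>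
     (\<exists>u v. u \<noteq> v \<and> p = mpoly_monom u - mpoly_monom v) \<and> total_degree p = 2"

definition toric_binomial :: "int vec \<Rightarrow> ('k::field) mpoly_nat" where
  "toric_binomial b =
     (\<Prod>i\<in>{i. i < dim_vec b \<and> b $ i > 0}. mpoly_var i ^ nat (b $ i)) -
     (\<Prod>j\<in>{j. j < dim_vec b \<and> b $ j < 0}. mpoly_var j ^ nat (- (b $ j)))"

definition toric_ideal :: "int mat \<Rightarrow> ('k::field) mpoly_nat set" where
  "toric_ideal A =
     genideal (poly_ring (dim_col A))
       {toric_binomial b | b. b \<in> carrier_vec (dim_col A) \<and> A *\<^sub>v b = 0\<^sub>v (dim_row A)}"

definition monomial_order :: "nat \<Rightarrow> monom_nat rel \<Rightarrow> bool" where
  "monomial_order m r \<longleftrightarrow>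
     linear_order_on (monomials m) r \<and>
     (\<forall>t\<in>monomials m. (0, t) \<in> r) \<and>
     (\<forall>s\<in>monomials m. \<forall>t\<in>monomials m. \<forall>u\<in>monomials m.
        (s, t) \<in> r \<longrightarrow> (s + u, t + u) \<in> r)"

definition leading_monom :: "monom_nat rel \<Rightarrow> ('k::field) mpoly_nat \<Rightarrow> monom_nat" where
  "leading_monom r p =
     (THE t. t \<in> Poly_Mapping.keys p \<and> (\<forall>s\<in>Poly_Mapping.keys p. (s, t) \<in> r))"

definition leading_ideal ::
    "nat \<Rightarrow> monom_nat rel \<Rightarrow> ('k::field) mpoly_nat set \<Rightarrow> 'k mpoly_nat set" where
  "leading_ideal m r F =
     genideal (poly_ring m) {mpoly_monom (leading_monom r f) | f. f \<in> F \<and> f \<noteq> 0}"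

definition groebner_basis ::
    "nat \<Rightarrow> monom_nat rel \<Rightarrow> ('k::field) mpoly_nat set \<Rightarrow> 'k mpoly_nat set \<Rightarrow> bool" where
  "groebner_basis m r I G \<longleftrightarrow>
     finite G \<and> G \<subseteq> I \<and> leading_ideal m r G = leading_ideal m r I"

definition has_quadratic_groebner_basis :: "nat \<Rightarrow> ('k::field) mpoly_nat set \<Rightarrow> bool" where
  "has_quadratic_groebner_basis m I \<longleftrightarrow>
     (\<exists>r G. monomial_order m r \<and> groebner_basis m r I G \<and> (\<forall>g\<in>G. quadratic_binomial g))"

definition generated_by_quadratic_binomials ::
    "nat \<Rightarrow> ('k::field) mpoly_nat set \<Rightarrow> bool" where
  "generated_by_quadratic_binomials m I \<longleftrightarrow>
     (\<exists>B \<subseteq> carrier (poly_ring m). (\<forall>g\<in>B. quadratic_binomial g) \<and> I = genideal (poly_ring m) B)"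

end

theory Submission
  imports Defs "HOL-Library.Multiset" "HOL-Library.List_Lexorder"
begin

text \<open>
  A monomial is a multigraph on \<open>V\<close> with loops allowed; its degree with respect to the extended
  incidence matrix is its multiset of endpoints. The quadratic binomials of the toric ideal are the
  moves replacing two edges \<open>il\<close>, \<open>jk\<close> by \<open>ik\<close>, \<open>jl\<close>.

  Along a strong perfect elimination ordering such a move exists whenever \<open>i < j\<close>, \<open>k < l\<close> and
  \<open>ik\<close> is an edge or a loop. All these moves decrease the monomial in a suitable reverse
  lexicographic order, and a monomial to which none applies is determined greedily by its vertex
  degrees; hence the quadratic binomials form a Groebner basis.

  Conversely, if the ideal is generated by quadratic binomials, then a monomial without quadratic
  move is alone in its degree. Order the vertices so that the rows of the reflexive adjacency matrix
  increase lexicographically. If this is not a strong perfect elimination ordering, the violation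
  grows into a chordless cycle or a sun, each of which carries a monomial without quadratic move that
  is not alone in its degree.
\<close>

section \<open>Ideals of the polynomial ring\<close>

text \<open>The columns of \<open>2E_n\<close> supply a loop at every vertex, so a vertex can be
  paired with itself: the edges of a cycle have the same vertex degrees as all its loops. This is
  why the reflexive adjacency matrix governs the ideal. The coefficients enter mainly through one
  remark: on every ideal element they sum to 0 over each fiber. The rest is combinatorics of fibers.

  For the converse, neither chordality nor absence of suns is known at the start; each has to be
  bought with a monomial. All these monomials have one shape: vertices \<open>r a\<close> and
  \<open>s a\<close> are matched by two bijections \<open>f\<close> and \<open>g\<close>, and the
  two edge products have equal degree because a bijection only reorders the \<open>s a\<close>.
  Cycles are excluded before suns, since independence of the rays of a sun rests on perfect
  elimination.

  The growing configurations stay induced because each new vertex is the last one that the lexical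
  order permits: an unwanted adjacency to an old vertex would produce a still later one.\<close>

lemma monomials_zero [simp]: "0 \<in> monomials m"
  by (simp add: monomials_def)

lemma monomials_add_iff [simp]: "s + t \<in> monomials m \<longleftrightarrow> s \<in> monomials m \<and> t \<in> monomials m"
  by (auto simp: monomials_def subset_iff in_keys_iff lookup_add)

lemma monomials_sum: "(\<And>x. x \<in> A \<Longrightarrow> f x \<in> monomials m) \<Longrightarrow> sum f A \<in> monomials m"
  by (induction A rule: infinite_finite_induct) auto

lemma poly_ring_simps [simp]:
  "monoid.mult (poly_ring m) = (*)" "one (poly_ring m) = 1" "zero (poly_ring m) = 0"
  "add (poly_ring m) = (+)"
  by (simp_all add: poly_ring_def)

lemma carrier_poly_ring_iff: "p \<in> carrier (poly_ring m) \<longleftrightarrow> Poly_Mapping.keys p \<subseteq> monomials m"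
  by (simp add: poly_ring_def)

lemma poly_ring_closed:
  fixes p q :: "('k::field) mpoly_nat"
  assumes "p \<in> carrier (poly_ring m)" "q \<in> carrier (poly_ring m)"
  shows "p + q \<in> carrier (poly_ring m)" "p * q \<in> carrier (poly_ring m)"
    "p - q \<in> carrier (poly_ring m)"
proof -
  note keys = assms[unfolded carrier_poly_ring_iff]
  show "p + q \<in> carrier (poly_ring m)"
    using keys Poly_Mapping.keys_add[of p q] unfolding carrier_poly_ring_iff by blast
  show "p * q \<in> carrier (poly_ring m)"
    using keys keys_mult[of p q] unfolding carrier_poly_ring_iff by fastforce
  show "p - q \<in> carrier (poly_ring m)"
    using keys keys_diff[of p q] unfolding carrier_poly_ring_iff by blast
qed

lemma poly_ring_uminus_closed [simp]:
  "- p \<in> carrier (poly_ring m) \<longleftrightarrow> (p :: ('k::field) mpoly_nat) \<in> carrier (poly_ring m)"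
  by (simp add: carrier_poly_ring_iff subset_iff in_keys_iff)

lemma zero_in_poly_ring [simp]: "0 \<in> carrier (poly_ring m)"
  by (simp add: carrier_poly_ring_iff)

lemma one_in_poly_ring [simp]: "1 \<in> carrier (poly_ring m)"
  by (simp add: carrier_poly_ring_iff)

lemma mpoly_monom_in_poly_ring_iff [simp]:
  "mpoly_monom t \<in> carrier (poly_ring m) \<longleftrightarrow> t \<in> monomials m"
  by (simp add: carrier_poly_ring_iff mpoly_monom_def)

lemma cring_poly_ring: "cring (poly_ring m :: ('k::field) mpoly_nat ring)"
proof (rule cringI)
  show "abelian_group (poly_ring m :: 'k mpoly_nat ring)"
  proof (rule abelian_groupI)
    show "\<exists>y\<in>carrier (poly_ring m). y \<oplus>\<^bsub>poly_ring m\<^esub> x = \<zero>\<^bsub>poly_ring m\<^esub>"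
      if "x \<in> carrier (poly_ring m)" for x :: "'k mpoly_nat"
      using that by (intro bexI[of _ "- x"]) auto
  qed (auto intro: poly_ring_closed simp: algebra_simps)
  show "comm_monoid (poly_ring m :: 'k mpoly_nat ring)"
    by (rule comm_monoidI) (auto intro: poly_ring_closed simp: algebra_simps)
qed (simp add: algebra_simps)

lemma ring_poly_ring: "ring (poly_ring m :: ('k::field) mpoly_nat ring)"
  using cring_poly_ring by (rule cring.axioms(1))

lemma a_inv_poly_ring:
  fixes p :: "('k::field) mpoly_nat"
  assumes "p \<in> carrier (poly_ring m)"
  shows "\<ominus>\<^bsub>poly_ring m\<^esub> p = - p"
proof -
  interpret ring "poly_ring m :: 'k mpoly_nat ring" by (rule ring_poly_ring)
  show ?thesis
    using assms by (intro minus_equality) auto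
qed

lemma ideal_poly_ringI:
  fixes J :: "('k::field) mpoly_nat set"
  assumes "J \<subseteq> carrier (poly_ring m)" "0 \<in> J"
    and add: "\<And>p q. p \<in> J \<Longrightarrow> q \<in> J \<Longrightarrow> p + q \<in> J"
    and mult: "\<And>h p. h \<in> carrier (poly_ring m) \<Longrightarrow> p \<in> J \<Longrightarrow> h * p \<in> J"
  shows "ideal J (poly_ring m)"
proof (rule idealI)
  interpret ring "poly_ring m :: 'k mpoly_nat ring" by (rule ring_poly_ring)
  show "subgroup J (add_monoid (poly_ring m))"
  proof (rule add.subgroupI)
    show "\<ominus>\<^bsub>poly_ring m\<^esub> p \<in> J" if "p \<in> J" for p
    proof -
      have p: "p \<in> carrier (poly_ring m)"
        using that assms(1) by auto
      have "- 1 * p \<in> J"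
        using that by (intro mult) auto
      then show ?thesis
        using p by (simp add: a_inv_poly_ring)
    qed
  qed (use assms in auto)
  show "a \<otimes>\<^bsub>poly_ring m\<^esub> x \<in> J" if "a \<in> J" "x \<in> carrier (poly_ring m)" for a x
    using mult[OF that(2,1)] by (simp add: mult.commute)
qed (use assms in \<open>auto intro: ring_poly_ring\<close>)

lemma ideal_poly_ringD:
  fixes J :: "('k::field) mpoly_nat set"
  assumes "ideal J (poly_ring m)"
  shows "J \<subseteq> carrier (poly_ring m)" "0 \<in> J"
    "p \<in> J \<Longrightarrow> q \<in> J \<Longrightarrow> p + q \<in> J"
    "h \<in> carrier (poly_ring m) \<Longrightarrow> p \<in> J \<Longrightarrow> h * p \<in> J"
proof -
  interpret ideal J "poly_ring m" by fact
  show "J \<subseteq> carrier (poly_ring m)" using a_subset by auto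
  show "0 \<in> J" using additive_subgroup.zero_closed[OF additive_subgroup_axioms] by simp
  show "p \<in> J \<Longrightarrow> q \<in> J \<Longrightarrow> p + q \<in> J" using additive_subgroup.a_closed[OF additive_subgroup_axioms] by auto
  show "h \<in> carrier (poly_ring m) \<Longrightarrow> p \<in> J \<Longrightarrow> h * p \<in> J" using I_l_closed by auto
qed

lemma poly_mapping_eq_sum_single:
  "p = (\<Sum>t\<in>Poly_Mapping.keys p. Poly_Mapping.single t (Poly_Mapping.lookup p t))"
proof (rule poly_mapping_eqI)
  fix k
  show "Poly_Mapping.lookup p k = Poly_Mapping.lookup
    (\<Sum>t\<in>Poly_Mapping.keys p. Poly_Mapping.single t (Poly_Mapping.lookup p t)) k"
    by (cases "k \<in> Poly_Mapping.keys p")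
      (auto simp: lookup_sum lookup_single when_def in_keys_iff)
qed

text \<open>Multipliers shrink to single terms: the elements all of whose multiples satisfy
  \<open>Q\<close> form an ideal because \<open>Q\<close> is additive, and splitting a multiplier
  into its terms puts \<open>S\<close> into it. So \<open>Q\<close> may be a linear condition such
  as a vanishing coefficient.\<close>

lemma genideal_poly_ring_induct [consumes 2, case_names gen zero add]:
  fixes p :: "('k::field) mpoly_nat"
  assumes "S \<subseteq> carrier (poly_ring m)" "p \<in> genideal (poly_ring m) S"
    and gen: "\<And>t c s. t \<in> monomials m \<Longrightarrow> s \<in> S \<Longrightarrow> Q (Poly_Mapping.single t c * s)"
    and zero: "Q 0" and add: "\<And>p q. Q p \<Longrightarrow> Q q \<Longrightarrow> Q (p + q)"
  shows "Q p"
proof -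
  interpret ring "poly_ring m :: 'k mpoly_nat ring" by (rule ring_poly_ring)
  define J where "J = {p \<in> carrier (poly_ring m). \<forall>h\<in>carrier (poly_ring m). Q (h * p)}"
  have sumQ: "Q (\<Sum>t\<in>A. f t)" if "finite A" "\<And>t. t \<in> A \<Longrightarrow> Q (f t)"
    for A and f :: "monom_nat \<Rightarrow> 'k mpoly_nat"
    using that by (induction A rule: finite_induct) (auto intro: zero add)
  have "ideal J (poly_ring m)"
  proof (rule ideal_poly_ringI)
    show "x * p \<in> J" if "x \<in> carrier (poly_ring m)" "p \<in> J" for x p
      using that poly_ring_closed(2) unfolding J_def
      by (auto simp flip: mult.assoc)
  qed (auto simp: J_def distrib_left intro: zero add poly_ring_closed)
  moreover have "S \<subseteq> J"
  proof
    fix s assume s: "s \<in> S"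
    have "Q (h * s)" if h: "h \<in> carrier (poly_ring m)" for h
    proof -
      have "h * s = (\<Sum>t\<in>Poly_Mapping.keys h. Poly_Mapping.single t (Poly_Mapping.lookup h t) * s)"
        by (subst poly_mapping_eq_sum_single[of h]) (rule sum_distrib_right)
      moreover have "Q \<dots>"
        using s h by (intro sumQ gen) (auto simp: carrier_poly_ring_iff)
      ultimately show ?thesis by simp
    qed
    then show "s \<in> J"
      using s assms(1) by (auto simp: J_def)
  qed
  ultimately have "p \<in> J"
    using genideal_minimal[of J S] assms(2) by blast
  then have "Q (1 * p)"
    using one_in_poly_ring unfolding J_def by blast
  then show ?thesis by simp
qed

lemma lookup_single_times_monom_diff:
  "Poly_Mapping.lookup (Poly_Mapping.single t c * (mpoly_monom u - mpoly_monom v)) s =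
     (c when s = t + u) - (c when s = t + v)"
  by (simp add: mpoly_monom_def right_diff_distrib mult_single lookup_minus lookup_single
      when_def eq_commute)

lemma keys_mpoly_monom_diff:
  assumes "u \<noteq> v"
  shows "Poly_Mapping.keys (mpoly_monom u - mpoly_monom v :: ('k::field) mpoly_nat) = {u, v}"
  using assms by (auto simp: in_keys_iff mpoly_monom_def lookup_minus lookup_single when_def
      split: if_splits)

lemma mpoly_monom_add: "mpoly_monom (s + t) = mpoly_monom s * mpoly_monom t"
  by (simp add: mpoly_monom_def mult_single)

text \<open>Divisibility of every support monomial by a member of \<open>T\<close> holds for term
  multiples of generators and survives sums; for a single monomial it is the claim.\<close>

lemma mpoly_monom_in_monomial_ideal:
  assumes "T \<subseteq> monomials m"
    and "mpoly_monom u \<in> genideal (poly_ring m) (mpoly_monom ` T :: ('k::field) mpoly_nat set)"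
  obtains a t where "a \<in> T" "t \<in> monomials m" "u = a + t"
proof -
  let ?Q = "\<lambda>p :: 'k mpoly_nat. \<forall>u\<in>Poly_Mapping.keys p. \<exists>a\<in>T. \<exists>t\<in>monomials m. u = a + t"
  have "mpoly_monom ` T \<subseteq> carrier (poly_ring m :: 'k mpoly_nat ring)"
    using assms(1) by auto
  then have "?Q (mpoly_monom u)"
    using assms(2)
  proof (induction rule: genideal_poly_ring_induct)
    case (gen t c s)
    then show ?case
      by (auto simp: mpoly_monom_def mult_single add.commute[of t] split: if_splits) blast
  next
    case (add p q)
    then show ?case
      using Poly_Mapping.keys_add[of p q] by blast
  qed simp
  then show ?thesis
    using that by (auto simp: mpoly_monom_def)
qed

section \<open>Degrees and leading monomials\<close>

lemma monom_degree_eq_sum: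
  assumes "t \<in> monomials m"
  shows "monom_degree t = (\<Sum>x<m. Poly_Mapping.lookup t x)"
  unfolding monom_degree_def using assms
  by (intro sum.mono_neutral_left) (auto simp: monomials_def in_keys_iff)

lemma monom_degree_zero [simp]: "monom_degree 0 = 0"
  by (simp add: monom_degree_def)

lemma monom_degree_eq_0_iff [simp]: "monom_degree t = 0 \<longleftrightarrow> t = 0"
  by (auto simp: monom_degree_def in_keys_iff poly_mapping_eq_iff fun_eq_iff)

lemma monom_degree_add [simp]: "monom_degree (s + t) = monom_degree s + monom_degree t"
proof -
  define m where "m = Suc (Max (insert 0 (Poly_Mapping.keys s \<union> Poly_Mapping.keys t)))"
  have "s \<in> monomials m" "t \<in> monomials m"
    unfolding monomials_def m_def by (auto intro!: Max_ge le_imp_less_Suc)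
  then show ?thesis
    by (simp add: monom_degree_eq_sum lookup_add sum.distrib)
qed

lemma monom_degree_single [simp]: "monom_degree (Poly_Mapping.single x k) = k"
  by (simp add: monom_degree_def)

lemma finite_monomials_degree: "finite {t \<in> monomials m. monom_degree t = d}"
proof -
  have "inj_on (\<lambda>t. map (Poly_Mapping.lookup t) [0..<m]) (monomials m)"
  proof (rule inj_onI, rule poly_mapping_eqI)
    fix s t x
    assume "s \<in> monomials m" "t \<in> monomials m"
      and "map (Poly_Mapping.lookup s) [0..<m] = map (Poly_Mapping.lookup t) [0..<m]"
    then show "Poly_Mapping.lookup s x = Poly_Mapping.lookup t x"
      by (cases "x < m") (auto simp: monomials_def in_keys_iff subset_iff, metis gr0I)
  qed
  moreover have "(\<lambda>t. map (Poly_Mapping.lookup t) [0..<m]) ` {t \<in> monomials m. monom_degree t = d}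
      \<subseteq> {xs. set xs \<subseteq> {..d} \<and> length xs = m}"
    by (auto simp: monom_degree_eq_sum intro!: member_le_sum)
  ultimately show ?thesis
    by (intro finite_imageD[OF finite_subset[OF _ finite_lists_length_eq[OF finite_atMost]]])
      (auto intro: inj_on_subset)
qed

lemma total_degree_monom_diff:
  assumes "u \<noteq> v"
  shows "total_degree (mpoly_monom u - mpoly_monom v :: ('k::field) mpoly_nat) =
    max (monom_degree u) (monom_degree v)"
  using assms by (simp add: total_degree_def keys_mpoly_monom_diff)

lemma linear_order_finite_greatest:
  assumes "linear_order_on S r" "finite A" "A \<noteq> {}" "A \<subseteq> S"
  shows "\<exists>t\<in>A. \<forall>s\<in>A. (s, t) \<in> r"
  using assms(2-)
proof (induction rule: finite_ne_induct)
  case (singleton x)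
  then show ?case
    using assms(1) by (auto simp: linear_order_on_def partial_order_on_def preorder_on_def refl_on_def)
next
  case (insert x F)
  then obtain t where t: "t \<in> F" "\<forall>s\<in>F. (s, t) \<in> r" by auto
  have tr: "trans r" and rf: "(x, x) \<in> r" and tot: "(x, t) \<in> r \<or> (t, x) \<in> r"
    using assms(1) insert.prems insert.hyps t
    by (auto simp: linear_order_on_def partial_order_on_def preorder_on_def refl_on_def total_on_def)
  show ?case
    using t tr rf tot by (metis insert_iff transD)
qed

lemma leading_monom_eqI:
  assumes "monomial_order m r" "p \<in> carrier (poly_ring m)"
    and "t \<in> Poly_Mapping.keys p" "\<And>s. s \<in> Poly_Mapping.keys p \<Longrightarrow> (s, t) \<in> r"
  shows "leading_monom r p = t"
  unfolding leading_monom_def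
proof (rule the_equality)
  have "antisym r"
    using assms(1) by (auto simp: monomial_order_def linear_order_on_def partial_order_on_def)
  then show "\<And>u. u \<in> Poly_Mapping.keys p \<and> (\<forall>s\<in>Poly_Mapping.keys p. (s, u) \<in> r) \<Longrightarrow> u = t"
    using assms by (auto dest: antisymD)
qed (use assms in auto)

lemma leading_monom_greatest:
  assumes "monomial_order m r" "p \<in> carrier (poly_ring m)" "p \<noteq> 0"
  shows "leading_monom r p \<in> Poly_Mapping.keys p"
    "s \<in> Poly_Mapping.keys p \<Longrightarrow> (s, leading_monom r p) \<in> r"
proof -
  have "\<exists>t\<in>Poly_Mapping.keys p. \<forall>s\<in>Poly_Mapping.keys p. (s, t) \<in> r"
    using assms by (intro linear_order_finite_greatest[of "monomials m"])
      (auto simp: monomial_order_def carrier_poly_ring_iff)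
  then obtain t where t: "t \<in> Poly_Mapping.keys p" "\<And>s. s \<in> Poly_Mapping.keys p \<Longrightarrow> (s, t) \<in> r"
    by auto
  have "leading_monom r p = t"
    using leading_monom_eqI[OF assms(1,2) t] by simp
  then show "leading_monom r p \<in> Poly_Mapping.keys p"
    "s \<in> Poly_Mapping.keys p \<Longrightarrow> (s, leading_monom r p) \<in> r"
    using t by auto
qed

section \<open>Ideals of graded binomials\<close>

lemma ideal_poly_ring_diff:
  fixes J :: "('k::field) mpoly_nat set"
  assumes "ideal J (poly_ring m)" "p \<in> J" "q \<in> J"
  shows "p - q \<in> J"
proof -
  have "- 1 * q \<in> J"
    using assms by (intro ideal_poly_ringD(4)[OF assms(1)]) auto
  then have "p + - 1 * q \<in> J"
    using assms by (intro ideal_poly_ringD(3)[OF assms(1)])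
  then show ?thesis by simp
qed

text \<open>\<open>W\<close> is the multidegree, kept as a multiset of vertices instead of a vector.
  The factor 2 counts the two ends of each variable; it forces monomials of equal multidegree to
  have equal degree, so fibers are finite.\<close>

locale monomial_grading =
  fixes m :: nat and W :: "monom_nat \<Rightarrow> 'v multiset"
  assumes W_add: "W (s + t) = W s + W t"
    and size_W: "t \<in> monomials m \<Longrightarrow> size (W t) = 2 * monom_degree t"
begin

definition fiber :: "'v multiset \<Rightarrow> monom_nat set" where
  "fiber w = {t \<in> monomials m. W t = w}"

definition fiber_binomials :: "('k::field) mpoly_nat set" where
  "fiber_binomials = {mpoly_monom u - mpoly_monom v | u v.
     u \<in> monomials m \<and> v \<in> monomials m \<and> W u = W v}"

definition fiber_ideal :: "('k::field) mpoly_nat set" where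
  "fiber_ideal = genideal (poly_ring m) fiber_binomials"

definition quadratic_fiber_binomials :: "('k::field) mpoly_nat set" where
  "quadratic_fiber_binomials = {mpoly_monom a - mpoly_monom b | a b.
     a \<in> monomials m \<and> b \<in> monomials m \<and> W a = W b \<and> a \<noteq> b \<and> monom_degree a = 2}"

text \<open>Standard monomials with respect to the quadratic binomials:
  \<open>(b, a) \<in> r\<close> makes \<open>a\<close> the leading monomial of
  \<open>a - b\<close>.\<close>

definition reduced :: "monom_nat rel \<Rightarrow> monom_nat \<Rightarrow> bool" where
  "reduced r u \<longleftrightarrow> \<not> (\<exists>a b t. a \<in> monomials m \<and> b \<in> monomials m \<and> t \<in> monomials m \<and>
     monom_degree a = 2 \<and> W a = W b \<and> a \<noteq> b \<and> (b, a) \<in> r \<and> u = a + t)"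

lemma same_fiber_degree:
  "s \<in> monomials m \<Longrightarrow> t \<in> monomials m \<Longrightarrow> W s = W t \<Longrightarrow> monom_degree s = monom_degree t"
  using size_W[of s] size_W[of t] by simp

lemma finite_fiber: "finite (fiber w)"
proof -
  have "fiber w \<subseteq> {t \<in> monomials m. monom_degree t = size w div 2}"
    using size_W by (auto simp: fiber_def)
  then show ?thesis
    by (rule finite_subset) (rule finite_monomials_degree)
qed

lemma fiber_binomials_subset: "fiber_binomials \<subseteq> carrier (poly_ring m)"
  by (auto simp: fiber_binomials_def intro!: poly_ring_closed)

lemma ideal_fiber_ideal: "ideal fiber_ideal (poly_ring m)"
  unfolding fiber_ideal_def
  by (intro ring.genideal_ideal ring_poly_ring fiber_binomials_subset)

lemma fiber_ideal_subset: "fiber_ideal \<subseteq> carrier (poly_ring m)"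
  using ideal_poly_ringD(1)[OF ideal_fiber_ideal] .

lemma fiber_ideal_binomialI:
  assumes "u \<in> monomials m" "v \<in> monomials m" "W u = W v"
  shows "mpoly_monom u - mpoly_monom v \<in> fiber_ideal"
  unfolding fiber_ideal_def using assms
  by (intro subsetD[OF ring.genideal_self[OF ring_poly_ring fiber_binomials_subset]])
    (auto simp: fiber_binomials_def)

text \<open>A term times a generator has both monomials in one fiber, with opposite coefficients.
  This linear condition detects the multihomogeneous binomials and later provides a second support
  monomial in the fiber of a leading monomial.\<close>

lemma fiber_ideal_coeff_sum:
  fixes p :: "('k::field) mpoly_nat"
  assumes "p \<in> fiber_ideal"
  shows "(\<Sum>t\<in>fiber w. Poly_Mapping.lookup p t) = 0"
  using fiber_binomials_subset assms[unfolded fiber_ideal_def]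
proof (induction rule: genideal_poly_ring_induct)
  case (gen t c s)
  then obtain u v where s: "s = mpoly_monom u - mpoly_monom v"
    and uv: "u \<in> monomials m" "v \<in> monomials m" "W u = W v"
    by (auto simp: fiber_binomials_def)
  have "t + u \<in> fiber w \<longleftrightarrow> t + v \<in> fiber w"
    using uv by (simp add: fiber_def W_add)
  then show ?case
    by (simp add: s lookup_single_times_monom_diff sum_subtractf when_def finite_fiber)
qed (simp_all add: lookup_add sum.distrib)

lemma fiber_ideal_binomialD:
  assumes "(mpoly_monom u - mpoly_monom v :: ('k::field) mpoly_nat) \<in> fiber_ideal" "u \<noteq> v"
  shows "u \<in> monomials m" "v \<in> monomials m" "W u = W v"
proof -
  let ?p = "mpoly_monom u - mpoly_monom v :: 'k mpoly_nat"
  show u: "u \<in> monomials m" and v: "v \<in> monomials m"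
    using subsetD[OF fiber_ideal_subset assms(1)] keys_mpoly_monom_diff[OF assms(2), where 'k = 'k]
    by (auto simp: carrier_poly_ring_iff)
  have "(\<Sum>t\<in>fiber (W u). Poly_Mapping.lookup ?p t) = 0"
    by (rule fiber_ideal_coeff_sum) fact
  also have "(\<Sum>t\<in>fiber (W u). Poly_Mapping.lookup ?p t) =
      (if u \<in> fiber (W u) then 1 else 0) - (if v \<in> fiber (W u) then 1 else 0)"
    by (simp add: mpoly_monom_def lookup_minus lookup_single sum_subtractf when_def finite_fiber)
  finally show "W u = W v"
    using u by (auto simp: fiber_def split: if_splits)
qed

lemma quadratic_binomial_in_fiber_ideal:
  assumes "(g :: ('k::field) mpoly_nat) \<in> fiber_ideal" "quadratic_binomial g"
  obtains a b where "g = mpoly_monom a - mpoly_monom b" "a \<in> monomials m" "b \<in> monomials m"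
    "W a = W b" "a \<noteq> b" "monom_degree a = 2" "monom_degree b = 2"
proof -
  obtain a b where ab: "a \<noteq> b" "g = mpoly_monom a - mpoly_monom b" and deg: "total_degree g = 2"
    using assms(2) by (auto simp: quadratic_binomial_def)
  have g: "(mpoly_monom a - mpoly_monom b :: 'k mpoly_nat) \<in> fiber_ideal"
    using assms(1) ab by simp
  note * = fiber_ideal_binomialD[OF g ab(1)]
  have "monom_degree a = monom_degree b"
    using same_fiber_degree * by blast
  moreover have "max (monom_degree a) (monom_degree b) = 2"
    using deg ab total_degree_monom_diff[OF ab(1), where 'k = 'k] by simp
  ultimately show ?thesis
    using that[of a b] ab * by simp
qed

text \<open>Were \<open>u\<close> free of moves, the coefficient of \<open>u\<close> would vanish on
  every term multiple of a quadratic generator, hence on the whole ideal, which contains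
  \<open>u - v\<close>.\<close>

lemma generated_imp_quadratic_move:
  assumes "generated_by_quadratic_binomials m (fiber_ideal :: ('k::field) mpoly_nat set)"
    and u: "u \<in> monomials m" and v: "v \<in> monomials m" and "W u = W v" "u \<noteq> v"
  obtains a b t where "a \<in> monomials m" "b \<in> monomials m" "t \<in> monomials m"
    "monom_degree a = 2" "W a = W b" "a \<noteq> b" "u = a + t"
proof (rule ccontr)
  assume "\<not> thesis"
  with that have isolated: "u \<noteq> a + t"
    if "a \<in> monomials m" "b \<in> monomials m" "t \<in> monomials m" "monom_degree a = 2" "W a = W b" "a \<noteq> b"
    for a b t using that by blast
  obtain B :: "'k mpoly_nat set" where B: "B \<subseteq> carrier (poly_ring m)"
    "\<And>g. g \<in> B \<Longrightarrow> quadratic_binomial g" "fiber_ideal = genideal (poly_ring m) B"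
    using assms(1) by (auto simp: generated_by_quadratic_binomials_def)
  have BI: "B \<subseteq> fiber_ideal"
    using B ring.genideal_self[OF ring_poly_ring B(1)] by simp
  have "Poly_Mapping.lookup p u = 0" if "p \<in> fiber_ideal" for p :: "'k mpoly_nat"
    using B(1) that[unfolded B(3)]
  proof (induction rule: genideal_poly_ring_induct)
    case (gen t c s)
    obtain a b where "s = mpoly_monom a - mpoly_monom b" "a \<in> monomials m" "b \<in> monomials m"
      "W a = W b" "a \<noteq> b" "monom_degree a = 2" "monom_degree b = 2"
      using quadratic_binomial_in_fiber_ideal gen B(2) BI by (metis subsetD)
    then show ?case
      using isolated[of a b t] isolated[of b a t] gen
      by (auto simp: lookup_single_times_monom_diff add.commute[of t])
  qed (auto simp: lookup_add)
  then have "Poly_Mapping.lookup (mpoly_monom u - mpoly_monom v :: 'k mpoly_nat) u = 0"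
    using fiber_ideal_binomialI assms by blast
  then show False
    using \<open>u \<noteq> v\<close> by (simp add: mpoly_monom_def lookup_minus lookup_single)
qed

section \<open>Groebner bases inside finite fibers\<close>

lemma leading_monom_binomial:
  assumes "monomial_order m r" "a \<in> monomials m" "b \<in> monomials m" "a \<noteq> b" "(b, a) \<in> r"
  shows "leading_monom r (mpoly_monom a - mpoly_monom b :: ('k::field) mpoly_nat) = a"
    "leading_monom r (mpoly_monom b - mpoly_monom a :: ('k::field) mpoly_nat) = a"
proof -
  have "(a, a) \<in> r"
    using assms by (auto simp: monomial_order_def linear_order_on_def partial_order_on_def
        preorder_on_def refl_on_def)
  then show "leading_monom r (mpoly_monom a - mpoly_monom b :: 'k mpoly_nat) = a"
    "leading_monom r (mpoly_monom b - mpoly_monom a :: 'k mpoly_nat) = a"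
    using assms keys_mpoly_monom_diff[OF assms(4), where 'k = 'k]
      keys_mpoly_monom_diff[OF assms(4)[symmetric], where 'k = 'k]
    by (auto intro!: leading_monom_eqI[OF assms(1)] poly_ring_closed)
qed

lemma leading_monoms_subset:
  assumes "monomial_order m r" "F \<subseteq> carrier (poly_ring m)"
  shows "{leading_monom r f | f. f \<in> F \<and> (f :: ('k::field) mpoly_nat) \<noteq> 0} \<subseteq> monomials m"
  using leading_monom_greatest(1)[OF assms(1)] assms(2)
  by (fastforce simp: carrier_poly_ring_iff)

lemma leading_ideal_altdef:
  "leading_ideal m r F = genideal (poly_ring m) (mpoly_monom ` {leading_monom r f | f. f \<in> F \<and> f \<noteq> 0})"
  unfolding leading_ideal_def by (rule arg_cong[where f = "genideal _"]) auto

lemma monomial_orderD: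
  assumes "monomial_order m r"
  shows "trans r" "antisym r" "r \<subseteq> monomials m \<times> monomials m"
    "s \<in> monomials m \<Longrightarrow> (s, s) \<in> r"
    "s \<in> monomials m \<Longrightarrow> t \<in> monomials m \<Longrightarrow> (s, t) \<in> r \<or> (t, s) \<in> r"
    "s \<in> monomials m \<Longrightarrow> t \<in> monomials m \<Longrightarrow> u \<in> monomials m \<Longrightarrow> (s, t) \<in> r \<Longrightarrow> (s + u, t + u) \<in> r"
  using assms unfolding monomial_order_def linear_order_on_def partial_order_on_def
    preorder_on_def refl_on_def total_on_def by metis+

lemma fiber_least:
  assumes "monomial_order m r" "fiber w \<noteq> {}"
  obtains z where "z \<in> fiber w" "\<And>u. u \<in> fiber w \<Longrightarrow> (z, u) \<in> r"
proof -
  have "linear_order_on (monomials m) (r\<inverse>)"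
    using assms(1) by (simp add: monomial_order_def)
  then have "\<exists>z\<in>fiber w. \<forall>u\<in>fiber w. (u, z) \<in> r\<inverse>"
    by (rule linear_order_finite_greatest) (use assms finite_fiber in \<open>auto simp: fiber_def\<close>)
  then show ?thesis using that by auto
qed

text \<open>Fibers are finite, so rewriting modulo the Groebner basis inside one fiber terminates
  without any appeal to Dickson's lemma.\<close>

lemma groebner_basis_imp_generated:
  assumes "has_quadratic_groebner_basis m (fiber_ideal :: ('k::field) mpoly_nat set)"
  shows "generated_by_quadratic_binomials m (fiber_ideal :: 'k mpoly_nat set)"
proof -
  obtain r and G :: "'k mpoly_nat set" where r: "monomial_order m r"
    and gb: "groebner_basis m r fiber_ideal G" and quad: "\<And>g. g \<in> G \<Longrightarrow> quadratic_binomial g"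
    using assms by (auto simp: has_quadratic_groebner_basis_def)
  note ro = monomial_orderD[OF r]
  have GI: "G \<subseteq> fiber_ideal" and lead: "leading_ideal m r G = leading_ideal m r fiber_ideal"
    using gb by (auto simp: groebner_basis_def)
  have Gc: "G \<subseteq> carrier (poly_ring m)"
    using GI fiber_ideal_subset by blast
  let ?J = "genideal (poly_ring m) G"
  have idJ: "ideal ?J (poly_ring m)"
    by (intro ring.genideal_ideal ring_poly_ring Gc)
  have GJ: "G \<subseteq> ?J"
    by (intro ring.genideal_self ring_poly_ring Gc)
  \<comment> \<open>\<open>u\<close> is the leading monomial of \<open>u - z\<close>, which lies in
    the ideal, so some element of \<open>G\<close> has a leading monomial dividing \<open>u\<close>;
    its other monomial gives the smaller \<open>u'\<close>.\<close>
  have step: "\<exists>u'\<in>fiber w. (u', u) \<in> r \<and> u' \<noteq> u \<and> mpoly_monom u - mpoly_monom u' \<in> ?J"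
    if z: "z \<in> fiber w" and u: "u \<in> fiber w" "u \<noteq> z" "(z, u) \<in> r" for z u w
  proof -
    let ?f = "mpoly_monom u - mpoly_monom z :: 'k mpoly_nat"
    have um: "u \<in> monomials m" and zm: "z \<in> monomials m" and W: "W u = W z" "W u = w"
      using z u by (auto simp: fiber_def)
    have f: "?f \<in> fiber_ideal"
      by (rule fiber_ideal_binomialI) fact+
    have f0: "?f \<noteq> 0"
      using keys_mpoly_monom_diff[OF u(2), where 'k = 'k] by auto
    have "leading_monom r ?f = u"
      by (rule leading_monom_binomial) (use r um zm u in auto)
    then have "mpoly_monom u \<in> (mpoly_monom `
        {leading_monom r f | f. f \<in> (fiber_ideal :: 'k mpoly_nat set) \<and> f \<noteq> 0} :: 'k mpoly_nat set)"
      using f f0 by (intro imageI CollectI exI[of _ ?f]) simp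
    also have "\<dots> \<subseteq> leading_ideal m r (fiber_ideal :: 'k mpoly_nat set)"
      unfolding leading_ideal_altdef
      by (rule ring.genideal_self[OF ring_poly_ring])
        (use leading_monoms_subset[OF r fiber_ideal_subset, where 'k = 'k] in auto)
    also have "\<dots> = genideal (poly_ring m) (mpoly_monom ` {leading_monom r f | f. f \<in> G \<and> f \<noteq> 0})"
      using lead unfolding leading_ideal_altdef by (rule sym)
    finally obtain g t where g: "g \<in> G" and t: "t \<in> monomials m" and ut: "u = leading_monom r g + t"
      using mpoly_monom_in_monomial_ideal[OF leading_monoms_subset[OF r Gc]] by blast
    obtain a b where ab: "g = mpoly_monom a - mpoly_monom b" "a \<in> monomials m" "b \<in> monomials m"
      "W a = W b" "a \<noteq> b"
      using quadratic_binomial_in_fiber_ideal quad[OF g] subsetD[OF GI g] by metis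
    have tg: "mpoly_monom t * g \<in> ?J" "- mpoly_monom t * g \<in> ?J"
      using g GJ t ideal_poly_ringD(4)[OF idJ, of "mpoly_monom t" g]
        ideal_poly_ringD(4)[OF idJ, of "- mpoly_monom t" g] by auto
    \<comment> \<open>The sign of \<open>g\<close> is unknown: \<open>a'\<close> names whichever of
      the two monomials leads.\<close>
    have "\<exists>a' b'. {a', b'} = {a, b} \<and> leading_monom r g = a' \<and> (b', a') \<in> r \<and>
        mpoly_monom (a' + t) - mpoly_monom (b' + t) \<in> ?J"
    proof (cases "(b, a) \<in> r")
      case True
      then have "leading_monom r g = a"
        using leading_monom_binomial(1)[OF r ab(2,3,5)] ab(1) by simp
      moreover have "mpoly_monom (a + t) - mpoly_monom (b + t) = mpoly_monom t * g"
        by (simp add: ab(1) mpoly_monom_add algebra_simps)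
      ultimately show ?thesis
        using True tg by metis
    next
      case False
      then have ba: "(a, b) \<in> r" using ro(5) ab by blast
      then have "leading_monom r g = b"
        using leading_monom_binomial(2)[OF r ab(3,2) ab(5)[symmetric]] ab(1) by simp
      moreover have "mpoly_monom (b + t) - mpoly_monom (a + t) \<in> ?J"
        using tg(2) by (simp add: ab(1) mpoly_monom_add algebra_simps)
      moreover have "{b, a} = {a, b}" by (rule insert_commute)
      ultimately show ?thesis
        using ba by blast
    qed
    then obtain a' b' where ab': "{a', b'} = {a, b}" "leading_monom r g = a'" "(b', a') \<in> r"
      "mpoly_monom (a' + t) - mpoly_monom (b' + t) \<in> ?J" by auto
    have "a' \<in> monomials m" "b' \<in> monomials m" "W a' = W b'" "a' \<noteq> b'"
      using ab'(1) ab by (auto simp: doubleton_eq_iff)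
    then show ?thesis
      using ab' ut W um ro(6) t by (intro bexI[of _ "b' + t"]) (auto simp: fiber_def W_add)
  qed
  have to_least: "mpoly_monom u - mpoly_monom z \<in> ?J"
    if z: "z \<in> fiber w" "\<And>u. u \<in> fiber w \<Longrightarrow> (z, u) \<in> r" and "u \<in> fiber w" for u z w
    using \<open>u \<in> fiber w\<close>
  proof (induction "card {s \<in> fiber w. (s, u) \<in> r}" arbitrary: u rule: less_induct)
    case less
    show ?case
    proof (cases "u = z")
      case True
      then show ?thesis using ideal_poly_ringD(2)[OF idJ] by simp
    next
      case False
      then obtain u' where u': "u' \<in> fiber w" "(u', u) \<in> r" "u' \<noteq> u"
        "mpoly_monom u - mpoly_monom u' \<in> ?J"
        using step[OF z(1) less.prems] z(2)[OF less.prems] by blast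
      have "{s \<in> fiber w. (s, u') \<in> r} \<subset> {s \<in> fiber w. (s, u) \<in> r}"
      proof (rule psubsetI)
        show "{s \<in> fiber w. (s, u') \<in> r} \<subseteq> {s \<in> fiber w. (s, u) \<in> r}"
          using u'(2) ro(1) by (auto dest: transD)
        have "(u, u') \<notin> r"
          using u'(2,3) ro(2) by (auto dest: antisymD)
        moreover have "(u, u) \<in> r"
          using less.prems ro(4) by (simp add: fiber_def)
        ultimately show "{s \<in> fiber w. (s, u') \<in> r} \<noteq> {s \<in> fiber w. (s, u) \<in> r}"
          using less.prems by blast
      qed
      from psubset_card_mono[OF _ this] have "mpoly_monom u' - mpoly_monom z \<in> ?J"
        using u'(1) by (intro less.hyps) (simp_all add: finite_fiber)
      from ideal_poly_ringD(3)[OF idJ u'(4) this] show ?thesis by simp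
    qed
  qed
  have "fiber_binomials \<subseteq> ?J"
  proof
    fix p :: "'k mpoly_nat" assume "p \<in> fiber_binomials"
    then obtain u v where p: "p = mpoly_monom u - mpoly_monom v"
      and uv: "u \<in> fiber (W u)" "v \<in> fiber (W u)"
      by (auto simp: fiber_binomials_def fiber_def)
    obtain z where z: "z \<in> fiber (W u)" "\<And>s. s \<in> fiber (W u) \<Longrightarrow> (z, s) \<in> r"
      using fiber_least[OF r] uv by blast
    have "p = (mpoly_monom u - mpoly_monom z) - (mpoly_monom v - mpoly_monom z)"
      by (simp add: p)
    then show "p \<in> ?J"
      using ideal_poly_ring_diff[OF idJ to_least[OF z uv(1)] to_least[OF z uv(2)]] by simp
  qed
  then have "fiber_ideal \<subseteq> ?J"
    unfolding fiber_ideal_def by (intro ring.genideal_minimal ring_poly_ring idJ)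
  moreover have "?J \<subseteq> fiber_ideal"
    by (intro ring.genideal_minimal ring_poly_ring ideal_fiber_ideal GI)
  ultimately show ?thesis
    unfolding generated_by_quadratic_binomials_def using Gc quad by blast
qed

text \<open>The leading monomial \<open>u\<close> of an ideal element is not least in its fiber, as
  the coefficient sum forces a second support monomial there. The least monomial of a fiber is
  reduced, so uniqueness makes \<open>u\<close> reducible: a quadratic leading monomial divides it.
  This bypasses S-pairs.\<close>

lemma unique_reduced_imp_groebner_basis:
  assumes r: "monomial_order m r"
    and unique: "\<And>u v. u \<in> monomials m \<Longrightarrow> v \<in> monomials m \<Longrightarrow> W u = W v \<Longrightarrow>
      reduced r u \<Longrightarrow> reduced r v \<Longrightarrow> u = v"
  shows "has_quadratic_groebner_basis m (fiber_ideal :: ('k::field) mpoly_nat set)"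
proof -
  let ?G = "quadratic_fiber_binomials :: 'k mpoly_nat set"
  note ro = monomial_orderD[OF r]
  have "?G \<subseteq> (\<lambda>(a, b). mpoly_monom a - mpoly_monom b) `
      ({t \<in> monomials m. monom_degree t = 2} \<times> {t \<in> monomials m. monom_degree t = 2})"
  proof
    fix g assume "g \<in> ?G"
    then obtain a b where "g = mpoly_monom a - mpoly_monom b" "a \<in> monomials m" "b \<in> monomials m"
      "W a = W b" "monom_degree a = 2"
      by (auto simp: quadratic_fiber_binomials_def)
    then show "g \<in> (\<lambda>(a, b). mpoly_monom a - mpoly_monom b) `
      ({t \<in> monomials m. monom_degree t = 2} \<times> {t \<in> monomials m. monom_degree t = 2})"
      using same_fiber_degree[of a b] by auto
  qed
  then have finG: "finite ?G"
    by (rule finite_subset) (intro finite_imageI finite_cartesian_product finite_monomials_degree)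
  have GI: "?G \<subseteq> fiber_ideal"
    by (auto simp: quadratic_fiber_binomials_def intro!: fiber_ideal_binomialI)
  have quad: "quadratic_binomial g" if g: "g \<in> ?G" for g
  proof -
    obtain a b where "g = mpoly_monom a - mpoly_monom b" "a \<in> monomials m" "b \<in> monomials m"
      "W a = W b" "a \<noteq> b" "monom_degree a = 2"
      using g by (auto simp: quadratic_fiber_binomials_def)
    then show ?thesis
      using same_fiber_degree[of a b] total_degree_monom_diff[of a b, where 'k = 'k]
      by (auto simp: quadratic_binomial_def)
  qed
  have divisible: "\<exists>a\<in>{leading_monom r f | f. f \<in> ?G \<and> f \<noteq> 0}. \<exists>t\<in>monomials m.
      leading_monom r f = a + t"
    if f: "f \<in> fiber_ideal" "f \<noteq> 0" for f :: "'k mpoly_nat"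
  proof -
    define u where "u = leading_monom r f"
    have fc: "f \<in> carrier (poly_ring m)"
      using f fiber_ideal_subset by blast
    have uk: "u \<in> Poly_Mapping.keys f" and le: "\<And>s. s \<in> Poly_Mapping.keys f \<Longrightarrow> (s, u) \<in> r"
      using leading_monom_greatest[OF r fc f(2)] by (auto simp: u_def)
    have um: "u \<in> monomials m"
      using uk fc by (auto simp: carrier_poly_ring_iff)
    obtain v where v: "v \<in> fiber (W u)" "v \<noteq> u" "v \<in> Poly_Mapping.keys f"
    proof -
      have "u \<in> fiber (W u)"
        using um by (simp add: fiber_def)
      then have "(\<Sum>t\<in>fiber (W u) - {u}. Poly_Mapping.lookup f t) = - Poly_Mapping.lookup f u"
        using fiber_ideal_coeff_sum[OF f(1), of "W u"] finite_fiber[of "W u"]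
        by (simp add: sum.remove eq_neg_iff_add_eq_0 add.commute)
      then have "(\<Sum>t\<in>fiber (W u) - {u}. Poly_Mapping.lookup f t) \<noteq> 0"
        using uk by (simp add: in_keys_iff)
      then obtain v where "v \<in> fiber (W u) - {u}" "Poly_Mapping.lookup f v \<noteq> 0"
        by (meson sum.neutral)
      then show ?thesis using that[of v] by (auto simp: in_keys_iff)
    qed
    obtain z where z: "z \<in> fiber (W u)" "\<And>s. s \<in> fiber (W u) \<Longrightarrow> (z, s) \<in> r"
      using fiber_least[OF r] v by blast
    have "reduced r z"
      unfolding reduced_def
    proof clarify
      fix a b t
      assume *: "a \<in> monomials m" "b \<in> monomials m" "t \<in> monomials m" "W a = W b" "a \<noteq> b"
        "(b, a) \<in> r" "z = a + t"
      then have "b + t \<in> fiber (W u)"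
        using z(1) by (auto simp: fiber_def W_add)
      then have "(a + t, b + t) \<in> r"
        using z(2) * by blast
      moreover have "(b + t, a + t) \<in> r"
        using ro(6) * by blast
      ultimately show False
        using * ro(2) by (auto dest: antisymD)
    qed
    moreover have "z \<noteq> u"
      using z(2)[OF v(1)] le[OF v(3)] v(2) ro(2) by (auto dest: antisymD)
    ultimately have "\<not> reduced r u"
      using unique[of u z] um z(1) by (auto simp: fiber_def)
    then obtain a b t where ab: "a \<in> monomials m" "b \<in> monomials m" "t \<in> monomials m"
      "monom_degree a = 2" "W a = W b" "a \<noteq> b" "(b, a) \<in> r" "u = a + t"
      unfolding reduced_def by blast
    let ?g = "mpoly_monom a - mpoly_monom b :: 'k mpoly_nat"
    have "?g \<in> ?G"
      using ab by (auto simp: quadratic_fiber_binomials_def)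
    moreover have "?g \<noteq> 0"
      using keys_mpoly_monom_diff[OF ab(6), where 'k = 'k] by auto
    moreover have "leading_monom r ?g = a"
      by (rule leading_monom_binomial(1)) (use r ab in auto)
    ultimately have "a \<in> {leading_monom r f | f. f \<in> ?G \<and> f \<noteq> 0}"
      by (intro CollectI exI[of _ ?g]) simp
    then show ?thesis
      using ab unfolding u_def by blast
  qed
  let ?LG = "mpoly_monom ` {leading_monom r f | f. f \<in> ?G \<and> f \<noteq> 0} :: 'k mpoly_nat set"
  let ?LI = "mpoly_monom `
    {leading_monom r f | f. f \<in> fiber_ideal \<and> (f :: 'k mpoly_nat) \<noteq> 0} :: 'k mpoly_nat set"
  have LIc: "?LI \<subseteq> carrier (poly_ring m)"
    using leading_monoms_subset[OF r fiber_ideal_subset, where 'k = 'k] by auto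
  have LG: "?LG \<subseteq> ?LI"
    using GI by blast
  have LGc: "?LG \<subseteq> carrier (poly_ring m)"
    using LG LIc by blast
  have idG: "ideal (genideal (poly_ring m) ?LG) (poly_ring m)"
    by (intro ring.genideal_ideal ring_poly_ring LGc)
  have "genideal (poly_ring m) ?LI \<subseteq> genideal (poly_ring m) ?LG"
  proof (rule ring.genideal_minimal[OF ring_poly_ring idG], rule subsetI)
    fix p assume "p \<in> ?LI"
    then obtain f :: "'k mpoly_nat"
      where f: "f \<in> fiber_ideal" "f \<noteq> 0" "p = mpoly_monom (leading_monom r f)"
      by blast
    obtain a t where a: "a \<in> {leading_monom r f | f. f \<in> ?G \<and> f \<noteq> 0}" "t \<in> monomials m"
      "leading_monom r f = a + t"
      using divisible[OF f(1,2)] by blast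
    have "mpoly_monom a \<in> genideal (poly_ring m) ?LG"
      using ring.genideal_self[OF ring_poly_ring LGc] a(1) by blast
    then have "mpoly_monom t * mpoly_monom a \<in> genideal (poly_ring m) ?LG"
      by (intro ideal_poly_ringD(4)[OF idG]) (simp_all add: a)
    then show "p \<in> genideal (poly_ring m) ?LG"
      by (simp add: f a mpoly_monom_add mult.commute)
  qed
  moreover have "genideal (poly_ring m) ?LG \<subseteq> genideal (poly_ring m) ?LI"
    by (rule ring.subset_Idl_subset[OF ring_poly_ring LIc LG])
  ultimately have "leading_ideal m r ?G = leading_ideal m r fiber_ideal"
    unfolding leading_ideal_altdef by blast
  then show ?thesis
    unfolding has_quadratic_groebner_basis_def groebner_basis_def
    using r finG GI quad by blast
qed

end

section \<open>Degree reverse lexicographic orders\<close>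

text \<open>Negated exponents turn lexicographic comparison of lists into reverse lexicographic
  comparison of monomials. The head of \<open>xs\<close> is the smallest variable; the degree in
  front keeps \<open>0\<close> least.\<close>

definition revlex_key :: "nat list \<Rightarrow> monom_nat \<Rightarrow> int list" where
  "revlex_key xs t = int (monom_degree t) # map (\<lambda>x. - int (Poly_Mapping.lookup t x)) xs"

definition revlex_order :: "nat \<Rightarrow> nat list \<Rightarrow> monom_nat rel" where
  "revlex_order m xs =
     {(s, t). s \<in> monomials m \<and> t \<in> monomials m \<and> revlex_key xs s \<le> revlex_key xs t}"

lemma map_le_map_add_cancel:
  fixes f g h :: "'a \<Rightarrow> 'b::linordered_ab_group_add"
  shows "map f xs \<le> map g xs \<Longrightarrow> map (\<lambda>x. f x + h x) xs \<le> map (\<lambda>x. g x + h x) xs"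
  by (induction xs) auto

lemma monomial_order_revlex:
  assumes "set xs = {..<m}"
  shows "monomial_order m (revlex_order m xs)"
proof -
  have "inj_on (revlex_key xs) (monomials m)"
  proof (rule inj_onI, rule poly_mapping_eqI)
    fix s t x
    assume st: "s \<in> monomials m" "t \<in> monomials m" "revlex_key xs s = revlex_key xs t"
    show "Poly_Mapping.lookup s x = Poly_Mapping.lookup t x"
    proof (cases "x < m")
      case True
      then show ?thesis using st(3) assms by (auto simp: revlex_key_def)
    next
      case False
      then have "x \<notin> Poly_Mapping.keys s" "x \<notin> Poly_Mapping.keys t"
        using st by (auto simp: monomials_def)
      then show ?thesis by (simp add: in_keys_iff)
    qed
  qed
  then have "linear_order_on (monomials m) (revlex_order m xs)"
    unfolding linear_order_on_def partial_order_on_def preorder_on_def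
    by (auto simp: refl_on_def trans_def antisym_def total_on_def revlex_order_def inj_on_def)
  moreover have "(0, t) \<in> revlex_order m xs" if "t \<in> monomials m" for t
    using that monom_degree_eq_0_iff[of t]
    by (cases "t = 0") (auto simp: revlex_order_def revlex_key_def simp del: monom_degree_eq_0_iff)
  moreover have "(s + u, t + u) \<in> revlex_order m xs"
    if "s \<in> monomials m" "t \<in> monomials m" "u \<in> monomials m" "(s, t) \<in> revlex_order m xs" for s t u
  proof -
    let ?h = "\<lambda>x. - int (Poly_Mapping.lookup u x)"
    show ?thesis
      using that map_le_map_add_cancel[of "\<lambda>x. - int (Poly_Mapping.lookup s x)" xs
          "\<lambda>x. - int (Poly_Mapping.lookup t x)" ?h]
      by (auto simp: revlex_order_def revlex_key_def lookup_add)
  qed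
  ultimately show ?thesis
    by (simp add: monomial_order_def)
qed

lemma revlex_orderI:
  assumes "s \<in> monomials m" "t \<in> monomials m" "monom_degree s = monom_degree t"
    and sorted: "sorted_wrt (\<lambda>x y. rk x < (rk y :: nat)) xs" and x: "x \<in> set xs"
    and eq: "\<And>y. y \<in> set xs \<Longrightarrow> rk y < rk x \<Longrightarrow> Poly_Mapping.lookup s y = Poly_Mapping.lookup t y"
    and less: "Poly_Mapping.lookup t x < Poly_Mapping.lookup s x"
  shows "(s, t) \<in> revlex_order m xs"
proof -
  obtain ys zs where xs: "xs = ys @ x # zs"
    using x by (meson split_list)
  have "\<forall>y\<in>set ys. Poly_Mapping.lookup s y = Poly_Mapping.lookup t y"
    using sorted eq xs by (auto simp: sorted_wrt_append)
  then have "map (\<lambda>x. - int (Poly_Mapping.lookup s x)) (ys @ x # zs) \<le>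
      map (\<lambda>x. - int (Poly_Mapping.lookup t x)) (ys @ x # zs)"
    using less by (induction ys) auto
  then show ?thesis
    using assms(1-3) by (simp add: revlex_order_def revlex_key_def xs)
qed

section \<open>Graphs with a loop at every vertex\<close>

text \<open>Four ends can be paired in three ways, and each pairing can be listed in two orders. The
  first way changes nothing; the other two are the possible quadratic moves on the edges
  \<open>pq\<close> and \<open>p'q'\<close>.\<close>

lemma two_pairs_mset_eq:
  assumes "{#p, q, p', q'#} = {#a, b, c, d#}"
  shows "({#a, b#} = {#p, q#} \<and> {#c, d#} = {#p', q'#}) \<or>
    ({#a, b#} = {#p', q'#} \<and> {#c, d#} = {#p, q#}) \<or>
    ({#a, b#} = {#p, p'#} \<and> {#c, d#} = {#q, q'#}) \<or>
    ({#a, b#} = {#q, q'#} \<and> {#c, d#} = {#p, p'#}) \<or>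
    ({#a, b#} = {#p, q'#} \<and> {#c, d#} = {#q, p'#}) \<or>
    ({#a, b#} = {#q, p'#} \<and> {#c, d#} = {#p, q'#})"
proof -
  have three: "(b = x \<and> {#c, d#} = {#y, z#}) \<or> (b = y \<and> {#c, d#} = {#x, z#}) \<or>
      (b = z \<and> {#c, d#} = {#x, y#})" if "{#b, c, d#} = {#x, y, z#}" for x y z
  proof -
    have "b \<in># {#x, y, z#}"
      using that by (metis union_single_eq_member add_mset_add_single multi_member_this)
    then consider "b = x" | "b = y" | "b = z" by auto
    then show ?thesis
      using that by cases (auto simp: add_mset_commute)
  qed
  have "a \<in># {#p, q, p', q'#}" using assms by simp
  then consider "a = p" | "a = q" | "a = p'" | "a = q'" by auto
  then show ?thesis
  proof cases
    case 1
    then have "{#b, c, d#} = {#q, p', q'#}" using assms by simp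
    then show ?thesis using three[of q p' q'] 1 by (auto simp: add_mset_commute)
  next
    case 2
    then have "{#b, c, d#} = {#p, p', q'#}" using assms by (simp add: add_mset_commute)
    then show ?thesis using three[of p p' q'] 2 by (auto simp: add_mset_commute)
  next
    case 3
    then have "{#b, c, d#} = {#p, q, q'#}" using assms by (simp add: add_mset_commute)
    then show ?thesis using three[of p q q'] 3 by (auto simp: add_mset_commute)
  next
    case 4
    then have "{#b, c, d#} = {#p, q, p'#}" using assms by (simp add: add_mset_commute)
    then show ?thesis using three[of p q p'] 4 by (auto simp: add_mset_commute)
  qed
qed

lemma mset_pair_set_eq: "{#a, b#} = {#c, d#} \<Longrightarrow> {a, b} = {c, d}"
  by (metis set_mset_add_mset_insert set_mset_empty)

lemma sum_single_remove:
  assumes "finite A" "(\<Sum>a\<in>A. Poly_Mapping.single (h a) (1::nat)) = Poly_Mapping.single x 1 + t"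
  obtains i where "i \<in> A" "h i = x" "(\<Sum>a\<in>A - {i}. Poly_Mapping.single (h a) (1::nat)) = t"
proof -
  have "Poly_Mapping.lookup (\<Sum>a\<in>A. Poly_Mapping.single (h a) (1::nat)) x > 0"
    unfolding assms(2) by (simp add: lookup_add)
  then obtain i where i: "i \<in> A" "h i = x"
    by (force simp: lookup_sum lookup_single when_def
        dest: sum.not_neutral_contains_not_neutral[OF less_imp_neq[symmetric]])
  have "(\<Sum>a\<in>A - {i}. Poly_Mapping.single (h a) (1::nat)) = t"
    using assms i by (simp add: sum.remove[OF assms(1) i(1)])
  then show ?thesis using that i by blast
qed

lemma monomial_split_var:
  assumes "u \<in> monomials m" "Poly_Mapping.lookup u x > 0"
  obtains t where "t \<in> monomials m" "u = Poly_Mapping.single x 1 + t" "x < m"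
proof -
  have "u = Poly_Mapping.single x 1 + (u - Poly_Mapping.single x 1)"
    using assms by (intro poly_mapping_eqI) (auto simp: lookup_add lookup_minus lookup_single when_def)
  moreover have "x < m"
    using assms by (auto simp: monomials_def in_keys_iff subset_iff)
  ultimately show ?thesis
    using that[of "u - Poly_Mapping.single x 1"] assms monomials_add_iff by metis
qed

text \<open>The variable \<open>x\<close> stands for the edge, or loop, with endpoints \<open>em x\<close>; a loop counts its
  vertex twice.\<close>

locale looped_graph =
  fixes V :: "'v set" and E :: "'v set set" and m :: nat and em :: "nat \<Rightarrow> 'v multiset"
  assumes finite_V: "finite V"
    and em_inj: "inj_on em {..<m}"
    and em_image: "em ` {..<m} = {{#u, v#} | u v. u \<in> V \<and> v \<in> V \<and> (u = v \<or> {u, v} \<in> E)}"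
begin

definition adj :: "'v \<Rightarrow> 'v \<Rightarrow> bool" where
  "adj u v \<longleftrightarrow> u \<in> V \<and> v \<in> V \<and> (u = v \<or> {u, v} \<in> E)"

definition W :: "monom_nat \<Rightarrow> 'v multiset" where
  "W t = (\<Sum>x<m. repeat_mset (Poly_Mapping.lookup t x) (em x))"

text \<open>Determined for adjacent pairs only, by injectivity of \<open>em\<close>; other values
  are unspecified.\<close>

definition evar :: "'v \<Rightarrow> 'v \<Rightarrow> nat" where
  "evar u v = (THE x. x < m \<and> em x = {#u, v#})"

definition emon :: "'v \<Rightarrow> 'v \<Rightarrow> monom_nat" where
  "emon u v = Poly_Mapping.single (evar u v) 1"

lemma adj_refl: "v \<in> V \<Longrightarrow> adj v v"
  by (simp add: adj_def)

lemma adj_sym: "adj u v \<Longrightarrow> adj v u"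
  by (auto simp: adj_def insert_commute)

lemma evar:
  assumes "adj u v"
  shows "evar u v < m" "em (evar u v) = {#u, v#}"
proof -
  have "{#u, v#} \<in> em ` {..<m}"
    unfolding em_image using assms by (auto simp: adj_def)
  then have "\<exists>!x. x < m \<and> em x = {#u, v#}"
    using em_inj by (auto simp: inj_on_def)
  then have "evar u v < m \<and> em (evar u v) = {#u, v#}"
    unfolding evar_def by (rule theI')
  then show "evar u v < m" "em (evar u v) = {#u, v#}" by auto
qed

lemma evar_commute: "evar u v = evar v u"
  by (simp add: evar_def add_mset_commute)

lemma emon_commute: "emon u v = emon v u"
  by (simp add: emon_def evar_commute)

lemma evar_mset_cong: "{#u, v#} = {#u', v'#} \<Longrightarrow> evar u v = evar u' v'"
  by (simp add: evar_def)

lemma evar_cases: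
  assumes "x < m"
  obtains u v where "adj u v" "x = evar u v" "em x = {#u, v#}"
proof -
  have "em x \<in> em ` {..<m}" using assms by simp
  then obtain u v where uv: "adj u v" "em x = {#u, v#}"
    unfolding em_image by (auto simp: adj_def)
  have "x = evar u v"
    using evar[OF uv(1)] em_inj assms uv(2) by (auto simp: inj_on_def)
  then show ?thesis using that uv by blast
qed

lemma emon_monomials [simp]: "adj u v \<Longrightarrow> emon u v \<in> monomials m"
  using evar(1) by (simp add: emon_def monomials_def)

lemma monom_degree_emon [simp]: "monom_degree (emon u v) = 1"
  by (simp add: emon_def)

lemma W_plus: "W (s + t) = W s + W t"
  by (intro multiset_eqI) (simp add: W_def count_sum lookup_add sum.distrib algebra_simps)

lemma W_single: "x < m \<Longrightarrow> W (Poly_Mapping.single x 1) = em x"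
  by (intro multiset_eqI)
    (simp add: W_def count_sum lookup_single when_def if_distrib[of "\<lambda>k. k * _"] cong: if_cong)

lemma W_emon [simp]: "adj u v \<Longrightarrow> W (emon u v) = {#u, v#}"
  using W_single[OF evar(1)] evar(2) by (simp add: emon_def)

lemma size_em: "x < m \<Longrightarrow> size (em x) = 2"
  by (rule evar_cases) auto

lemma W_size:
  assumes "t \<in> monomials m"
  shows "size (W t) = 2 * monom_degree t"
proof -
  have "size (W t) = (\<Sum>x<m. size (repeat_mset (Poly_Mapping.lookup t x) (em x)))"
    unfolding W_def by (induction m) auto
  also have "\<dots> = (\<Sum>x<m. Poly_Mapping.lookup t x * 2)"
    by (intro sum.cong) (auto simp: size_em)
  finally show ?thesis
    by (simp add: monom_degree_eq_sum[OF assms] sum_distrib_left mult.commute)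
qed

sublocale monomial_grading m W
  by unfold_locales (simp_all add: W_plus W_size)

lemma W_zero [simp]: "W 0 = {#}"
  by (simp add: W_def)

lemma W_sum: "W (sum h A) = (\<Sum>a\<in>A. W (h a))"
  by (induction A rule: infinite_finite_induct) (simp_all add: W_plus)

lemma W_subset_V: "v \<in># W t \<Longrightarrow> v \<in> V"
proof -
  assume "v \<in># W t"
  then have "count (W t) v \<noteq> 0" by simp
  then obtain x where "x < m" "v \<in># em x"
    unfolding W_def count_sum by (metis (no_types, lifting) sum.not_neutral_contains_not_neutral
        count_repeat_mset lessThan_iff mult_is_0 not_in_iff)
  then show "v \<in> V"
    by (auto elim!: evar_cases simp: adj_def)
qed

lemma split_emon:
  assumes "u \<in> monomials m" "v \<in># W u"
  obtains l t where "adj v l" "t \<in> monomials m" "u = emon v l + t"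
proof -
  have "count (W u) v \<noteq> 0" using assms(2) by simp
  then obtain x where x: "x < m" "v \<in># em x" "Poly_Mapping.lookup u x > 0"
    unfolding W_def count_sum by (metis (no_types, lifting) sum.not_neutral_contains_not_neutral
        count_repeat_mset lessThan_iff mult_is_0 not_in_iff gr0I)
  obtain a b where ab: "adj a b" "x = evar a b" "em x = {#a, b#}"
    using evar_cases[OF x(1)] .
  obtain t where t: "t \<in> monomials m" "u = Poly_Mapping.single x 1 + t"
    using monomial_split_var[OF assms(1) x(3)] by blast
  have "v = a \<or> v = b" using x ab by auto
  then show ?thesis
  proof
    assume "v = a"
    then show ?thesis using that[of b t] ab t by (simp add: emon_def)
  next
    assume "v = b"
    then show ?thesis using that[of a t] ab t adj_sym evar_commute by (simp add: emon_def)
  qed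
qed

lemma quadratic_monomial:
  assumes "a \<in> monomials m" "monom_degree a = 2"
  obtains p q p' q' where "adj p q" "adj p' q'" "a = emon p q + emon p' q'"
proof -
  have "size (W a) = 4" using W_size assms by simp
  then obtain p where "p \<in># W a"
    by (metis multiset_nonemptyE size_empty zero_neq_numeral)
  then obtain q t where 1: "adj p q" "t \<in> monomials m" "a = emon p q + t"
    using split_emon assms(1) by blast
  then have t: "monom_degree t = 1" using assms(2) by simp
  then have "size (W t) = 2" using W_size 1 by simp
  then obtain p' where "p' \<in># W t"
    by (metis multiset_nonemptyE size_empty zero_neq_numeral)
  then obtain q' t' where 2: "adj p' q'" "t = emon p' q' + t'"
    using split_emon 1(2) by blast
  then have "t' = 0" using t by simp
  then show ?thesis using that 1 2 by simp
qed

text \<open>If the product of the edges \<open>r\<^sub>a s\<^bsub>f a\<^esub>\<close> admits no quadratic move, then it is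
  the only monomial of its degree, so it equals the product of the edges
  \<open>r\<^sub>a s\<^bsub>g a\<^esub>\<close>.\<close>

lemma generated_imp_exchange:
  fixes r s :: "nat \<Rightarrow> 'v"
  assumes gen: "generated_by_quadratic_binomials m (fiber_ideal :: ('k::field) mpoly_nat set)"
    and f: "bij_betw f {..<k} {..<k}" and g: "bij_betw g {..<k} {..<k}"
    and edges: "\<forall>a<k. adj (r a) (s (f a)) \<and> adj (r a) (s (g a))"
    and no_move: "\<forall>a<k. \<forall>b<k. a \<noteq> b \<longrightarrow>
        (adj (r a) (r b) \<and> adj (s (f a)) (s (f b)) \<longrightarrow> r a = s (f b) \<or> s (f a) = r b) \<and>
        (adj (r a) (s (f b)) \<and> adj (s (f a)) (r b) \<longrightarrow> r a = r b \<or> s (f a) = s (f b))"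
    and j: "j < k"
  shows "\<exists>b<k. {r j, s (g j)} = {r b, s (f b)}"
proof -
  define mon where "mon h = (\<Sum>a<k. emon (r a) (s (h a)))" for h
  have mon_monomials: "mon f \<in> monomials m" "mon g \<in> monomials m"
    unfolding mon_def using edges by (auto intro!: monomials_sum)
  \<comment> \<open>\<open>h\<close> only permutes the ends \<open>s a\<close>, so the degree is the
    same for every bijection.\<close>
  have W_mon: "W (mon h) = (\<Sum>a<k. {#r a#}) + (\<Sum>a<k. {#s a#})"
    if "bij_betw h {..<k} {..<k}" "\<forall>a<k. adj (r a) (s (h a))" for h
  proof -
    have "W (mon h) = (\<Sum>a<k. {#r a#} + {#s (h a)#})"
      unfolding mon_def W_sum using that(2) by (intro sum.cong) auto
    also have "\<dots> = (\<Sum>a<k. {#r a#}) + (\<Sum>a<k. {#s (h a)#})"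
      by (rule sum.distrib)
    also have "(\<Sum>a<k. {#s (h a)#}) = (\<Sum>a<k. {#s a#})"
      using sum.reindex_bij_betw[OF that(1), of "\<lambda>a. {#s a#}"] .
    finally show ?thesis .
  qed
  have W_eq: "W (mon f) = W (mon g)"
    using W_mon[OF f] W_mon[OF g] edges by simp
  have "mon f = mon g"
  proof (rule ccontr)
    assume "mon f \<noteq> mon g"
    then obtain a b t where abt: "a \<in> monomials m" "b \<in> monomials m" "t \<in> monomials m"
      "monom_degree a = 2" "W a = W b" "a \<noteq> b" "mon f = a + t"
      using generated_imp_quadratic_move[OF gen mon_monomials W_eq] by blast
    have degb: "monom_degree b = 2"
      using same_fiber_degree[of a b] abt by simp
    obtain p q p' q' where a: "adj p q" "adj p' q'" "a = emon p q + emon p' q'"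
      using quadratic_monomial abt(1,4) by blast
    obtain x y x' y' where b: "adj x y" "adj x' y'" "b = emon x y + emon x' y'"
      using quadratic_monomial abt(2) degb by blast
    let ?h = "\<lambda>a. evar (r a) (s (f a))"
    have sum: "(\<Sum>a<k. Poly_Mapping.single (?h a) 1) =
        Poly_Mapping.single (evar p q) 1 + (Poly_Mapping.single (evar p' q') 1 + t)"
      using abt(7) a by (simp add: mon_def emon_def add.assoc)
    obtain i where i: "i < k" "?h i = evar p q"
      "(\<Sum>a\<in>{..<k} - {i}. Poly_Mapping.single (?h a) 1) = Poly_Mapping.single (evar p' q') 1 + t"
      using sum_single_remove[OF _ sum] by blast
    obtain i' where i': "i' \<in> {..<k} - {i}" "?h i' = evar p' q'"
      using sum_single_remove[OF _ i(3)] by blast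
    let ?p = "r i" and ?q = "s (f i)" and ?p' = "r i'" and ?q' = "s (f i')"
    have adj: "adj ?p ?q" "adj ?p' ?q'"
      using edges i i' by auto
    have a': "a = emon ?p ?q + emon ?p' ?q'"
      using a i i' by (simp add: emon_def)
    have "{#?p, ?q, ?p', ?q'#} = {#x, y, x', y'#}"
      using abt(5) a' b adj by (simp add: W_plus add_mset_commute)
    from two_pairs_mset_eq[OF this] consider
        "{#x, y#} = {#?p, ?q#}" "{#x', y'#} = {#?p', ?q'#}"
      | "{#x, y#} = {#?p', ?q'#}" "{#x', y'#} = {#?p, ?q#}"
      | "{#x, y#} = {#?p, ?p'#}" "{#x', y'#} = {#?q, ?q'#}"
      | "{#x, y#} = {#?q, ?q'#}" "{#x', y'#} = {#?p, ?p'#}"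
      | "{#x, y#} = {#?p, ?q'#}" "{#x', y'#} = {#?q, ?p'#}"
      | "{#x, y#} = {#?q, ?p'#}" "{#x', y'#} = {#?p, ?q'#}"
      by blast
    note cases = this
    have emon_cong: "emon c d = emon c' d'" if "{#c, d#} = {#c', d'#}" for c d c' d'
      using evar_mset_cong[OF that] by (simp add: emon_def)
    have adj_cong: "adj c' d'" if "{#c, d#} = {#c', d'#}" "adj c d" for c d c' d'
      using that adj_sym by (auto simp: add_eq_conv_ex)
    \<comment> \<open>A re-pairing that exists in the graph is harmless: \<open>no_move\<close>
      makes two ends coincide, and then the new edges are the old ones.\<close>
    have parallel: "emon ?p ?p' + emon ?q ?q' = a" if "adj ?p ?p'" "adj ?q ?q'"
    proof -
      have "?p = ?q' \<or> ?q = ?p'" using no_move that i i' by auto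
      then show ?thesis
        unfolding a' by (auto simp: add.commute emon_commute)
    qed
    have crossing: "emon ?p ?q' + emon ?q ?p' = a" if "adj ?p ?q'" "adj ?q ?p'"
    proof -
      have "?p = ?p' \<or> ?q = ?q'" using no_move that i i' by auto
      then show ?thesis
        unfolding a' by (auto simp: add.commute emon_commute)
    qed
    from cases have "b = a"
    proof cases
      case 1
      then show ?thesis using emon_cong b a' by metis
    next
      case 2
      then show ?thesis using emon_cong b a' add.commute by metis
    next
      case 3
      then show ?thesis using emon_cong[OF 3(1)] emon_cong[OF 3(2)] adj_cong b parallel by metis
    next
      case 4
      then show ?thesis
        using emon_cong[OF 4(1)] emon_cong[OF 4(2)] adj_cong b parallel add.commute by metis
    next
      case 5
      then show ?thesis using emon_cong[OF 5(1)] emon_cong[OF 5(2)] adj_cong b crossing by metis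
    next
      case 6
      then show ?thesis
        using emon_cong[OF 6(1)] emon_cong[OF 6(2)] adj_cong b crossing add.commute by metis
    qed
    then show False using abt(6) by simp
  qed
  \<comment> \<open>Equal monomials have equal factors: the edge that \<open>g\<close> gives to
    \<open>r j\<close> must occur among the edges of \<open>f\<close>.\<close>
  then have sum: "(\<Sum>a<k. Poly_Mapping.single (evar (r a) (s (f a))) 1) =
      Poly_Mapping.single (evar (r j) (s (g j))) 1 +
      (\<Sum>a\<in>{..<k} - {j}. Poly_Mapping.single (evar (r a) (s (g a))) (1::nat))"
    using j by (simp add: mon_def emon_def sum.remove[of "{..<k}" j])
  obtain b where b: "b < k" "evar (r b) (s (f b)) = evar (r j) (s (g j))"
    using sum_single_remove[OF _ sum] by blast
  then have "{#r j, s (g j)#} = {#r b, s (f b)#}"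
    using evar(2) edges j by metis
  then show ?thesis
    using mset_pair_set_eq b(1) by metis
qed

end

section \<open>Lexically ordered adjacency matrices\<close>

text \<open>Vertices are replaced by their positions. \<open>lexical\<close> compares rows with the
  last column most significant; by \<open>sym\<close> the columns are ordered in the same way, so
  the matrix is doubly lexically ordered. \<open>exchange\<close> is what quadratic generation
  leaves behind once the algebra is gone.\<close>

locale lexical_matrix =
  fixes n :: nat and M :: "nat \<Rightarrow> nat \<Rightarrow> bool"
  assumes refl: "a < n \<Longrightarrow> M a a"
    and sym: "M a b \<Longrightarrow> M b a"
    and lexical: "\<lbrakk>a < b; b < n; c < n; M a c; \<not> M b c\<rbrakk> \<Longrightarrow> \<exists>d>c. d < n \<and> \<not> M a d \<and> M b d"
    and exchange: "\<lbrakk>bij_betw f {..<k} {..<k::nat}; bij_betw g {..<k} {..<k};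
      \<forall>a<k. r a < n \<and> s a < n; \<forall>a<k. M (r a) (s (f a)) \<and> M (r a) (s (g a));
      \<forall>a<k. \<forall>b<k. a \<noteq> b \<longrightarrow>
        (M (r a) (r b) \<and> M (s (f a)) (s (f b)) \<longrightarrow> r a = s (f b) \<or> s (f a) = r b) \<and>
        (M (r a) (s (f b)) \<and> M (s (f a)) (r b) \<longrightarrow> r a = r b \<or> s (f a) = s (f b)); j < k\<rbrakk>
      \<Longrightarrow> \<exists>b<k. {r j, s (g j)} = {r b, s (f b)}"
begin

lemma sym_iff: "M a b \<longleftrightarrow> M b a"
  using sym by blast

text \<open>The last column witnessing \<open>lexical\<close> is taken, because its closing property
  is what keeps a growing path or staircase induced.\<close>

lemma lexical_greatest:
  assumes "a < b" "b < n" "c < n" "M a c" "\<not> M b c"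
  obtains d where "c < d" "d < n" "\<not> M a d" "M b d"
    "\<And>e. d < e \<Longrightarrow> e < n \<Longrightarrow> M b e \<Longrightarrow> M a e"
proof -
  let ?D = "{d. c < d \<and> d < n \<and> \<not> M a d \<and> M b d}"
  have fin: "finite ?D" by (rule finite_subset[of _ "{..<n}"]) auto
  have ne: "?D \<noteq> {}" using lexical[OF assms] by blast
  have "Max ?D \<in> ?D" using fin ne by (rule Max_in)
  moreover have "M a e" if "Max ?D < e" "e < n" "M b e" for e
  proof (rule ccontr)
    assume "\<not> M a e"
    moreover have "c < e" using that(1) \<open>Max ?D \<in> ?D\<close> by auto
    ultimately have "e \<in> ?D" using that by auto
    then have "e \<le> Max ?D" using fin by (intro Max_ge)
    then show False using that(1) by simp
  qed
  ultimately show ?thesis using that[of "Max ?D"] by blast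
qed

end

text \<open>The vertices \<open>0, \<dots>, K\<close> are arranged on a cycle as
  \<open>\<dots>, 4, 2, 0, 1, 3, 5, \<dots>\<close>, the order in which the lexical ordering reveals them.\<close>

definition cycle_adj :: "nat \<Rightarrow> nat \<Rightarrow> nat \<Rightarrow> bool" where
  "cycle_adj K i j \<longleftrightarrow> j = i + 2 \<or> i = j + 2 \<or> (i = 0 \<and> j = 1) \<or> (i = 1 \<and> j = 0) \<or>
     (i + 1 = K \<and> j = K) \<or> (j + 1 = K \<and> i = K)"

text \<open>One turn around the cycle: up the odd numbers, across the closing edge between
  \<open>K - 1\<close> and \<open>K\<close>, down the even numbers, and from \<open>0\<close> to
  \<open>1\<close>.\<close>

definition cycle_next :: "nat \<Rightarrow> nat \<Rightarrow> nat" where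
  "cycle_next K a = (if a = 0 then 1 else if odd a then
     (if a + 2 \<le> K then a + 2 else if a = K then K - 1 else K) else a - 2)"

lemma cycle_next_le: "3 \<le> K \<Longrightarrow> a \<le> K \<Longrightarrow> cycle_next K a \<le> K"
  by (auto simp: cycle_next_def)

lemma cycle_adj_next: "3 \<le> K \<Longrightarrow> a \<le> K \<Longrightarrow> cycle_adj K a (cycle_next K a)"
  unfolding cycle_adj_def cycle_next_def by (auto; presburger)

lemma cycle_next_inj:
  assumes "3 \<le> K" "a \<le> K" "b \<le> K" "cycle_next K a = cycle_next K b"
  shows "a = b"
  using assms unfolding cycle_next_def by (auto split: if_splits; presburger)

lemma cycle_next_next: "3 \<le> K \<Longrightarrow> a \<le> K \<Longrightarrow> cycle_next K (cycle_next K a) \<noteq> a"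
  unfolding cycle_next_def by (auto split: if_splits; presburger)

lemma bij_betw_cycle_next: "3 \<le> K \<Longrightarrow> bij_betw (cycle_next K) {..<Suc K} {..<Suc K}"
  by (intro bij_betw_imageI endo_inj_surj)
    (auto simp: less_Suc_eq_le inj_on_def cycle_next_le dest: cycle_next_inj)

lemma cycle_adj_sym: "cycle_adj K a b \<longleftrightarrow> cycle_adj K b a"
  by (auto simp: cycle_adj_def)

lemma cycle_adj_irrefl: "2 \<le> K \<Longrightarrow> \<not> cycle_adj K a a"
  by (auto simp: cycle_adj_def)

text \<open>Serves to recover a vertex from its two neighbours; the cases are the generic vertex,
  then \<open>0\<close> and \<open>1\<close>, then the two ends of the closing edge.\<close>

lemma cycle_adj_pair:
  assumes "3 \<le> K" "a \<le> K" "b \<le> K" "c \<le> K" "cycle_adj K b a" "cycle_adj K b c" "a < c"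
  shows "(b = a + 2 \<and> c = a + 4) \<or> (b = 0 \<and> a = 1 \<and> c = 2) \<or> (b = 1 \<and> a = 0 \<and> c = 3) \<or>
    (b + 1 = K \<and> a + 3 = K \<and> c = K) \<or> (b = K \<and> a + 2 = K \<and> c + 1 = K)"
  using assms unfolding cycle_adj_def by (elim disjE conjE; simp)

lemma cycle_adj_no_triangle:
  assumes "4 \<le> K" "a \<le> K" "b \<le> K" "c \<le> K" "cycle_adj K a b" "cycle_adj K b c" "cycle_adj K c a"
  shows False
proof -
  have *: False if "cycle_adj K b x" "cycle_adj K b y" "cycle_adj K y x" "x < y" "x \<le> K" "y \<le> K" for x y
  proof -
    have "3 \<le> K" using assms by simp
    note cycle_adj_pair[OF this that(5) assms(3) that(6) that(1,2,4)]
    then show False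
      using that(3,4) assms(1) unfolding cycle_adj_def by (elim disjE conjE; linarith)
  qed
  have "a \<noteq> c"
    using assms cycle_adj_irrefl[of K a] by auto
  then show ?thesis
    using *[of a c] *[of c a] assms cycle_adj_sym by (metis linorder_neqE_nat)
qed

text \<open>For \<open>K = 3\<close> the cycle is itself a square and the claim fails; hence squares
  have a certificate of their own.\<close>

lemma cycle_adj_no_square:
  assumes "4 \<le> K" "a \<le> K" "b \<le> K" "c \<le> K" "d \<le> K"
    "cycle_adj K a b" "cycle_adj K b c" "cycle_adj K c d" "cycle_adj K d a"
  shows "a = c \<or> b = d"
proof -
  have *: "b = d" if "cycle_adj K b x" "cycle_adj K b y" "cycle_adj K d x" "cycle_adj K d y"
    "x < y" "x \<le> K" "y \<le> K" for x y
    using cycle_adj_pair[of K x b y] cycle_adj_pair[of K x d y] that assms(1-5) by auto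
  show ?thesis
    using *[of a c] *[of c a] assms cycle_adj_sym by (metis linorder_neqE_nat)
qed

text \<open>Adjacency between the rays (first argument) and the clique vertices (second argument) of
  a sun; \<open>sun_match\<close> and \<open>sun_match'\<close> are the two perfect matchings of this cycle.\<close>

definition sun_adj :: "nat \<Rightarrow> nat \<Rightarrow> nat \<Rightarrow> bool" where
  "sun_adj K a b \<longleftrightarrow> a = b + 1 \<or> b = a + 1 \<or> (a = 0 \<and> b = 0) \<or> (a = K \<and> b = K)"

definition sun_match :: "nat \<Rightarrow> nat \<Rightarrow> nat" where
  "sun_match K a = (if a = 0 then 0 else if odd a then (if a < K then a + 1 else a) else a - 1)"

definition sun_match' :: "nat \<Rightarrow> nat \<Rightarrow> nat" where
  "sun_match' K a = (if even a then (if a < K then a + 1 else a) else a - 1)"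

lemma inj_on_sun_match: "inj_on (sun_match K) {..<Suc K}"
  unfolding inj_on_def sun_match_def by (auto split: if_splits; presburger)

lemma inj_on_sun_match': "inj_on (sun_match' K) {..<Suc K}"
  unfolding inj_on_def sun_match'_def by (auto split: if_splits; presburger)

lemma bij_betw_sun_match: "bij_betw (sun_match K) {..<Suc K} {..<Suc K}"
  by (intro bij_betw_imageI endo_inj_surj inj_on_sun_match) (auto simp: sun_match_def)

lemma bij_betw_sun_match': "bij_betw (sun_match' K) {..<Suc K} {..<Suc K}"
  by (intro bij_betw_imageI endo_inj_surj inj_on_sun_match') (auto simp: sun_match'_def)

lemma sun_adj_match: "2 \<le> K \<Longrightarrow> a \<le> K \<Longrightarrow> sun_adj K a (sun_match K a)"
  unfolding sun_adj_def sun_match_def by auto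

lemma sun_adj_match': "2 \<le> K \<Longrightarrow> a \<le> K \<Longrightarrow> sun_adj K a (sun_match' K a)"
  unfolding sun_adj_def sun_match'_def by auto

lemma sun_match_neq: "2 \<le> K \<Longrightarrow> a \<le> K \<Longrightarrow> sun_match K a \<noteq> sun_match' K a"
  unfolding sun_match_def sun_match'_def by auto

lemma sun_match_le: "a \<le> K \<Longrightarrow> sun_match K a \<le> K" "a \<le> K \<Longrightarrow> sun_match' K a \<le> K"
  by (auto simp: sun_match_def sun_match'_def)

lemma sun_adj_pair:
  assumes "2 \<le> K" "a \<le> K" "c \<le> K" "d \<le> K" "c < d" "sun_adj K a c" "sun_adj K a d"
  shows "(c + 1 = a \<and> d = a + 1) \<or> (a = 0 \<and> c = 0 \<and> d = 1) \<or> (a = K \<and> c + 1 = K \<and> d = K)"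
  using assms unfolding sun_adj_def by (elim disjE conjE; linarith)

lemma sun_adj_no_square:
  assumes "2 \<le> K" "a \<le> K" "b \<le> K" "c \<le> K" "d \<le> K" "c \<noteq> d"
    "sun_adj K a c" "sun_adj K a d" "sun_adj K b c" "sun_adj K b d"
  shows "a = b"
proof -
  have *: "a = b" if "x < y" "x \<le> K" "y \<le> K" "sun_adj K a x" "sun_adj K a y"
    "sun_adj K b x" "sun_adj K b y" for x y
    using sun_adj_pair[of K a x y] sun_adj_pair[of K b x y] that assms(1-3) by auto
  show ?thesis
    using *[of c d] *[of d c] assms by (auto simp: neq_iff)
qed

section \<open>Excluding chordless cycles, then suns, from a lexical matrix\<close>

context lexical_matrix
begin

text \<open>Every vertex meets two edges of the cycle, so the product of these edges has the degree
  of the product of all loops: \<open>f\<close> steps along the cycle and \<open>g\<close> is the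
  identity. On at least five vertices a move on two of the edges would need a triangle or a square
  in the cycle, so \<open>exchange\<close> would make one of the edges a loop.\<close>

lemma no_induced_long_cycle:
  assumes K: "4 \<le> K" and less: "\<And>i. i \<le> K \<Longrightarrow> x i < n"
    and inj: "\<And>i j. i \<le> K \<Longrightarrow> j \<le> K \<Longrightarrow> x i = x j \<Longrightarrow> i = j"
    and adj: "\<And>i j. i \<le> K \<Longrightarrow> j \<le> K \<Longrightarrow> M (x i) (x j) \<longleftrightarrow> i = j \<or> cycle_adj K i j"
  shows False
proof -
  let ?f = "cycle_next K"
  have f: "?f a \<le> K" "cycle_adj K a (?f a)" "?f a \<noteq> a" "?f (?f a) \<noteq> a" if "a \<le> K" for a
    using that K cycle_next_le[of K a] cycle_adj_next[of K a] cycle_next_next[of K a]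
      cycle_adj_irrefl[of K a] by auto
  have finj: "a = b" if "a \<le> K" "b \<le> K" "?f a = ?f b" for a b
    using that K cycle_next_inj[of K a b] by simp
  have parallel: "a = ?f b \<or> ?f a = b"
    if ab: "a \<le> K" "b \<le> K" "a \<noteq> b" and "M (x a) (x b)" "M (x (?f a)) (x (?f b))" for a b
  proof -
    have "cycle_adj K b a" "cycle_adj K (?f a) (?f b)"
      using that adj f(1) finj cycle_adj_sym by metis+
    then show ?thesis
      using cycle_adj_no_square[of K a "?f a" "?f b" b] K ab f cycle_adj_sym by metis
  qed
  have crossing: False
    if ab: "a \<le> K" "b \<le> K" "a \<noteq> b" and "M (x a) (x (?f b))" "M (x (?f a)) (x b)" for a b
  proof -
    have *: "a = ?f b \<or> cycle_adj K a (?f b)" "?f a = b \<or> cycle_adj K (?f a) b"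
      using that adj f(1) by blast+
    \<comment> \<open>If the two edges share an end, one new pair is a loop and the other closes a
      triangle; otherwise both new pairs are edges and close a square.\<close>
    consider "a = ?f b" | "?f a = b" | "cycle_adj K a (?f b)" "cycle_adj K (?f a) b"
      using * by blast
    then show False
    proof cases
      case 1
      then have "cycle_adj K (?f a) b"
        using * f ab by metis
      then show False
        using cycle_adj_no_triangle[of K b a "?f a"] 1 K ab f by metis
    next
      case 2
      then have "cycle_adj K a (?f b)"
        using * f ab by metis
      then show False
        using cycle_adj_no_triangle[of K a b "?f b"] 2 K ab f cycle_adj_sym by metis
    next
      case 3
      then show False
        using cycle_adj_no_square[of K a "?f a" b "?f b"] K ab f finj cycle_adj_sym by metis
    qed
  qed
  have "\<exists>b<Suc K. {x 0, x (id 0)} = {x b, x (?f b)}"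
  proof (rule exchange[where f = ?f and g = id and r = x and s = x])
    show "bij_betw ?f {..<Suc K} {..<Suc K}"
      using K by (intro bij_betw_cycle_next) simp
    show "\<forall>a<Suc K. M (x a) (x (?f a)) \<and> M (x a) (x (id a))"
      using f adj by (auto simp: less_Suc_eq_le)
    show "\<forall>a<Suc K. \<forall>b<Suc K. a \<noteq> b \<longrightarrow>
      (M (x a) (x b) \<and> M (x (?f a)) (x (?f b)) \<longrightarrow> x a = x (?f b) \<or> x (?f a) = x b) \<and>
      (M (x a) (x (?f b)) \<and> M (x (?f a)) (x b) \<longrightarrow> x a = x b \<or> x (?f a) = x (?f b))"
      using parallel crossing less_Suc_eq_le by metis
  qed (use less in \<open>auto simp: less_Suc_eq_le\<close>)
  then obtain b where "b \<le> K" "x b = x (?f b)"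
    by (auto simp: less_Suc_eq_le)
  then show False
    using inj f by metis
qed

text \<open>In a chordless square \<open>0 1 3 2\<close>, the loop at \<open>0\<close> with the edges \<open>13\<close>, \<open>32\<close> has the same
  degrees as the edges \<open>02\<close>, \<open>01\<close> with the loop at \<open>3\<close>.\<close>

lemma no_induced_square:
  assumes less: "\<And>i. i \<le> 3 \<Longrightarrow> x i < n"
    and inj: "\<And>i j. i \<le> 3 \<Longrightarrow> j \<le> 3 \<Longrightarrow> x i = x j \<Longrightarrow> i = j"
    and adj: "\<And>i j. i \<le> 3 \<Longrightarrow> j \<le> 3 \<Longrightarrow> M (x i) (x j) \<longleftrightarrow> i = j \<or> cycle_adj 3 i j"
  shows False
proof -
  define r where "r = (\<lambda>a::nat. if a = 0 then x 0 else if a = 1 then x 1 else x 3)"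
  define s where "s = (\<lambda>a::nat. if a = 0 then x 0 else if a = 1 then x 3 else x 2)"
  define g where "g = (\<lambda>a::nat. if a = 0 then 2 else if a = 1 then 0 else (1::nat))"
  have less3: "a < 3 \<longleftrightarrow> a = 0 \<or> a = 1 \<or> a = 2" for a :: nat
    by auto
  have adj': "M (x 0) (x 0)" "M (x 0) (x 1)" "M (x 0) (x 2)" "\<not> M (x 0) (x 3)"
    "M (x 1) (x 0)" "M (x 1) (x 1)" "\<not> M (x 1) (x 2)" "M (x 1) (x 3)"
    "M (x 2) (x 0)" "\<not> M (x 2) (x 1)" "M (x 2) (x 2)" "M (x 2) (x 3)"
    "\<not> M (x 3) (x 0)" "M (x 3) (x 1)" "M (x 3) (x 2)" "M (x 3) (x 3)"
    by (simp_all add: adj cycle_adj_def)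
  have neq: "x 0 \<noteq> x 1" "x 0 \<noteq> x 2" "x 0 \<noteq> x 3" "x 1 \<noteq> x 2" "x 1 \<noteq> x 3" "x 2 \<noteq> x 3"
    using inj[of 0 1] inj[of 0 2] inj[of 0 3] inj[of 1 2] inj[of 1 3] inj[of 2 3] by auto
  have "\<exists>b<3. {r 0, s (g 0)} = {r b, s (id b)}"
  proof (rule exchange[where f = id and g = g and r = r and s = s])
    have "g ` {..<3} = {..<3}"
      by (auto simp: less3 g_def image_iff)
    moreover have "inj_on g {..<3}"
      by (auto simp: less3 g_def inj_on_def)
    ultimately show "bij_betw g {..<3} {..<3}"
      by (simp add: bij_betw_def)
    show "\<forall>a<3. r a < n \<and> s a < n"
      by (auto simp: r_def s_def less)
    show "\<forall>a<3. M (r a) (s (id a)) \<and> M (r a) (s (g a))"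
      by (auto simp: less3 r_def s_def g_def adj' simp del: One_nat_def)
    show "\<forall>a<3. \<forall>b<3. a \<noteq> b \<longrightarrow>
      (M (r a) (r b) \<and> M (s (id a)) (s (id b)) \<longrightarrow> r a = s (id b) \<or> s (id a) = r b) \<and>
      (M (r a) (s (id b)) \<and> M (s (id a)) (r b) \<longrightarrow> r a = r b \<or> s (id a) = s (id b))"
      by (auto simp: less3 r_def s_def adj' simp del: One_nat_def)
  qed auto
  then show False
    using neq by (auto simp: less3 r_def s_def g_def doubleton_eq_iff simp del: One_nat_def)
qed

lemma no_induced_cycle:
  assumes "3 \<le> K" and "\<And>i. i \<le> K \<Longrightarrow> x i < n"
    and mono: "\<And>i j. i < j \<Longrightarrow> j \<le> K \<Longrightarrow> x i < x j"
    and adj: "\<And>i j. i < j \<Longrightarrow> j \<le> K \<Longrightarrow> M (x i) (x j) \<longleftrightarrow> cycle_adj K i j"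
  shows False
proof -
  have inj: "i = j" if "i \<le> K" "j \<le> K" "x i = x j" for i j
    using mono[of i j] mono[of j i] that by (cases i j rule: linorder_cases) auto
  have adj': "M (x i) (x j) \<longleftrightarrow> i = j \<or> cycle_adj K i j" if "i \<le> K" "j \<le> K" for i j
  proof (cases i j rule: linorder_cases)
    case less
    then show ?thesis using adj that by blast
  next
    case equal
    then show ?thesis using refl assms(2) that by blast
  next
    case greater
    then show ?thesis using adj[of j i] that sym cycle_adj_sym by blast
  qed
  show False
  proof (cases "K = 3")
    case True
    then show False using no_induced_square[of x] inj adj' assms(2) by blast
  next
    case False
    then show False using no_induced_long_cycle[of K x] inj adj' assms(1,2) by force
  qed
qed

text \<open>The classical argument that lexicographic breadth-first search finds a perfect elimination
  ordering: from a violation one grows an induced path at alternating ends, which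
  would have to close up to a chordless cycle.\<close>

theorem perfect_elimination:
  assumes "a < b" "a < c" "b < n" "c < n" "M a b" "M a c"
  shows "M b c"
proof (rule ccontr)
  \<comment> \<open>The vertices increase and form the path
    \<open>..., x 4, x 2, x 0, x 1, x 3, ...\<close>, which grows at its two ends in turn. The last
    clause remembers that \<open>x (j + 3)\<close> was chosen last for the rows \<open>x j\<close>
    and \<open>x (j + 1)\<close>.\<close>
  define path where "path = (\<lambda>(x :: nat \<Rightarrow> nat) m. 2 \<le> m \<and> (\<forall>i\<le>m. x i < n) \<and>
    (\<forall>i j. i < j \<and> j \<le> m \<longrightarrow> x i < x j) \<and>
    (\<forall>i j. i < j \<and> j \<le> m \<longrightarrow> (M (x i) (x j) \<longleftrightarrow> (i = 0 \<and> j = 1) \<or> j = i + 2)) \<and>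
    (\<forall>j d. j + 3 \<le> m \<and> x (j + 3) < d \<and> d < n \<and> M (x (j + 1)) d \<longrightarrow> M (x j) d))"
  have start: "\<exists>x. path x 2" if "a < b" "b < c" "c < n" "M a b" "M a c" "\<not> M b c" for a b c
  proof -
    define x where "x = (\<lambda>i::nat. if i = 0 then a else if i = 1 then b else c)"
    have "i < j \<and> j \<le> 2 \<longleftrightarrow> (i = 0 \<and> j = 1) \<or> (i = 0 \<and> j = 2) \<or> (i = 1 \<and> j = 2)" for i j :: nat
      by auto
    then have "path x 2"
      unfolding path_def using that by (auto simp: x_def)
    then show ?thesis by blast
  qed
  have step: "\<exists>x. path x (Suc m)" if path: "path x m" for x m
  proof -
    obtain p where p: "m = p + 2"
      using path le_add_diff_inverse2[of 2 m] unfolding path_def by metis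
    have less: "x i < n" if "i \<le> p + 2" for i
      using path that by (simp add: path_def p)
    have mono: "x i < x j" if "i < j" "j \<le> p + 2" for i j
      using path that by (simp add: path_def p)
    have adj: "M (x i) (x j) \<longleftrightarrow> (i = 0 \<and> j = 1) \<or> j = i + 2" if "i < j" "j \<le> p + 2" for i j
      using path that by (simp add: path_def p)
    have greatest: "M (x j) d" if "j + 3 \<le> p + 2" "x (j + 3) < d" "d < n" "M (x (j + 1)) d" for j d
      using path that unfolding path_def p by blast
    obtain e where e: "x (p + 2) < e" "e < n" "\<not> M (x p) e" "M (x (p + 1)) e"
      and e_greatest: "\<And>d. e < d \<Longrightarrow> d < n \<Longrightarrow> M (x (p + 1)) d \<Longrightarrow> M (x p) d"
    proof (rule lexical_greatest[of "x p" "x (p + 1)" "x (p + 2)"])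
      show "x p < x (p + 1)" "x (p + 1) < n" "x (p + 2) < n"
        using mono less by auto
      show "M (x p) (x (p + 2))" "\<not> M (x (p + 1)) (x (p + 2))"
        using adj[of p "p + 2"] adj[of "p + 1" "p + 2"] by auto
    qed (use that in blast)
    \<comment> \<open>Downward from \<open>x p\<close>: if \<open>e\<close> were adjacent to
      \<open>x j\<close> but not to \<open>x (j + 1)\<close>, \<open>lexical\<close> would yield
      some \<open>d\<close> beyond \<open>e\<close> contradicting the maximality of
      \<open>x (j + 3)\<close>.\<close>
    have nonadj: "\<not> M (x j) e" if "j \<le> p" for j
      using that
    proof (induction rule: inc_induct)
      case (step j)
      show ?case
      proof
        assume "M (x j) e"
        then have "\<exists>d>e. d < n \<and> \<not> M (x j) d \<and> M (x (Suc j)) d"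
          using step mono[of j "Suc j"] less[of "Suc j"] e by (intro lexical) auto
        then obtain d where "e < d" "d < n" "\<not> M (x j) d" "M (x (j + 1)) d"
          by auto
        moreover have "x (j + 3) < d"
          using mono[of "j + 3" "p + 2"] e \<open>e < d\<close> step
          by (cases "j + 3 = p + 2") (auto simp: numeral_3_eq_3)
        ultimately show False
          using greatest[of j d] step by auto
      qed
    qed (use e in auto)
    define y where "y = x(p + 3 := e)"
    have y: "y i = x i" if "i \<le> p + 2" for i
      using that by (simp add: y_def)
    have ye: "y (p + 3) = e"
      by (simp add: y_def)
    have yless: "y i < n" if "i \<le> p + 3" for i
      using that less e y ye by (cases "i = p + 3") auto
    have ymono: "y i < y j" if "i < j" "j \<le> p + 3" for i j
    proof (cases "j = p + 3")
      case True
      have "x i \<le> x (p + 2)"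
        using mono[of i "p + 2"] that by (cases "i = p + 2") auto
      then show ?thesis
        using that True y ye e by simp
    next
      case False
      then show ?thesis using mono[of i j] that y by simp
    qed
    have yadj: "M (y i) (y j) \<longleftrightarrow> (i = 0 \<and> j = 1) \<or> j = i + 2 \<or> (i = p + 2 \<and> j = p + 3 \<and> M (x (p + 2)) e)"
      if ij: "i < j" "j \<le> p + 3" for i j
    proof (cases "j = p + 3")
      case True
      then consider "i = p + 2" | "i = p + 1" | "i \<le> p" using ij by linarith
      then show ?thesis
        using True y ye e nonadj by cases auto
    next
      case False
      then show ?thesis using adj[of i j] ij y by auto
    qed
    \<comment> \<open>The ends of the new path are \<open>x (p + 2)\<close> and \<open>e\<close>; an
      edge between them closes a chordless cycle with \<open>K = p + 3\<close>.\<close>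
    have "\<not> M (x (p + 2)) e"
    proof
      assume "M (x (p + 2)) e"
      then show False
        using no_induced_cycle[of "p + 3" y] yless ymono yadj by (auto simp: cycle_adj_def)
    qed
    moreover have "M (y j) d" if "j + 3 \<le> p + 3" "y (j + 3) < d" "d < n" "M (y (j + 1)) d" for j d
      using that greatest[of j d] e_greatest[of d] y ye by (cases "j = p") auto
    ultimately have "path y (Suc m)"
      using yless ymono yadj unfolding path_def p by (auto simp: numeral_3_eq_3)
    then show ?thesis by blast
  qed
  assume "\<not> M b c"
  then have "b \<noteq> c"
    using refl assms by auto
  then have "\<exists>x. path x 2"
    using start[of a b c] start[of a c b] assms \<open>\<not> M b c\<close> sym_iff by (metis linorder_neqE_nat)
  \<comment> \<open>The path grows without bound, while its increasing vertices stay below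
    \<open>n\<close>.\<close>
  then have "\<exists>x. path x (k + 2)" for k
    using step by (induction k) (simp_all add: numeral_2_eq_2, blast)
  then obtain x where "path x (n + 2)" by blast
  then have x: "\<And>i. i \<le> n + 2 \<Longrightarrow> x i < n" "\<And>i j. i < j \<Longrightarrow> j \<le> n + 2 \<Longrightarrow> x i < x j"
    by (auto simp: path_def)
  have "inj_on x {..n + 2}"
    using x(2) by (intro linorder_inj_onI) (auto dest: less_imp_neq)
  moreover have "x ` {..n + 2} \<subseteq> {..<n}"
    using x(1) by auto
  ultimately show False
    using card_inj_on_le[of x "{..n + 2}" "{..<n}"] by simp
qed

text \<open>As \<open>r 0\<close> precedes its neighbours \<open>s 0\<close> and \<open>s 1\<close>,
  these are adjacent, and perfect elimination propagates this to all consecutive \<open>s i\<close>.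
  On the way every ray except the last is seen to precede its neighbours among the
  \<open>s i\<close>, so a later ray adjacent to it would be adjacent to them too, against
  \<open>sun_adj\<close>.\<close>

lemma sun_rays_independent:
  assumes K: "2 \<le> K" and less: "\<And>a. a \<le> K \<Longrightarrow> r a < n" "\<And>a. a \<le> K \<Longrightarrow> s a < n"
    and mono: "\<And>a b. a < b \<Longrightarrow> b \<le> K \<Longrightarrow> r a < r b" "\<And>a b. a < b \<Longrightarrow> b \<le> K \<Longrightarrow> s a < s b"
    and adj: "\<And>a b. a \<le> K \<Longrightarrow> b \<le> K \<Longrightarrow> M (r a) (s b) \<longleftrightarrow> sun_adj K a b"
    and first: "r 0 < s 0"
    and ab: "a < b" "b \<le> K"
  shows "\<not> M (r a) (r b)"
proof
  assume M: "M (r a) (r b)"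
  have step: "r (Suc i) < s i \<and> M (s (Suc i)) (s (i + 2))"
    if i: "Suc i < K" and "M (s i) (s (Suc i))" for i
  proof -
    have 1: "\<not> M (r (Suc i)) (s (Suc i))" "M (r (Suc i)) (s i)" "M (r (Suc i)) (s (i + 2))"
      using i by (simp_all add: adj sun_adj_def)
    have 2: "s i < s (Suc i)" "s i < s (i + 2)" "s (Suc i) < n" "s (i + 2) < n" "r (Suc i) < n"
      using i mono(2)[of i "Suc i"] mono(2)[of i "i + 2"] less by auto
    \<comment> \<open>If \<open>s i\<close> came first, its later neighbours
      \<open>r (Suc i)\<close> and \<open>s (Suc i)\<close> would be adjacent.\<close>
    have "\<not> s i < r (Suc i)"
      using perfect_elimination[of "s i" "r (Suc i)" "s (Suc i)"] 1 2 that(2) sym by blast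
    moreover have "s i \<noteq> r (Suc i)"
      using 1 that(2) by metis
    ultimately have 3: "r (Suc i) < s i" by linarith
    then have "M (s i) (s (i + 2))"
      using perfect_elimination[of "r (Suc i)" "s i" "s (i + 2)"] 1 2 by simp
    then have "M (s (Suc i)) (s (i + 2))"
      using perfect_elimination[of "s i" "s (Suc i)" "s (i + 2)"] 2 that(2) by simp
    then show ?thesis using 3 by simp
  qed
  have chain: "M (s i) (s (Suc i))" if "i < K" for i
    using that
  proof (induction i)
    case 0
    have "M (r 0) (s 0)" "M (r 0) (s 1)"
      using K by (simp_all add: adj sun_adj_def)
    then show ?case
      using perfect_elimination[of "r 0" "s 0" "s 1"] first mono(2)[of 0 1] less K by simp
  next
    case (Suc i)
    then show ?case using step[of i] by simp
  qed
  have rab: "r a < r b" "r b < n"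
    using mono ab less by auto
  show False
  proof (cases a)
    case 0
    have "M (r 0) (s 0)" "M (r 0) (s 1)"
      using K by (simp_all add: adj sun_adj_def)
    moreover have "s 0 < s 1" "s 0 < n" "s 1 < n"
      using mono(2)[of 0 1] less K by auto
    ultimately have "M (r b) (s 0)" "M (r b) (s 1)"
      using perfect_elimination[of "r 0" "r b" "s 0"] perfect_elimination[of "r 0" "r b" "s 1"]
        M rab first 0 by auto
    then have "sun_adj K b 0" "sun_adj K b 1"
      using adj ab K by auto
    then show False
      using 0 ab K by (auto simp: sun_adj_def)
  next
    case (Suc i)
    then have i: "Suc i < K" using ab by simp
    then have "r a < s i" "M (r a) (s i)" "s i < n"
      using step[of i] chain[of i] Suc less by (auto simp: adj sun_adj_def)
    then have "M (r b) (s i)"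
      using perfect_elimination[of "r a" "r b" "s i"] M rab by simp
    then have "sun_adj K b i"
      using adj ab i by simp
    then show False
      using Suc ab by (auto simp: sun_adj_def)
  qed
qed

text \<open>The cycle alternating between the \<open>r a\<close> and the \<open>s b\<close> has two
  perfect matchings of the same degree. Moves on \<open>sun_match\<close> are blocked: one
  re-pairing joins two rays, the other needs a square in the alternating cycle. So
  \<open>exchange\<close> would place an edge of \<open>sun_match'\<close> in
  \<open>sun_match\<close>.\<close>

lemma no_sun:
  assumes K: "2 \<le> K" and less: "\<And>a. a \<le> K \<Longrightarrow> r a < n" "\<And>a. a \<le> K \<Longrightarrow> s a < n"
    and mono: "\<And>a b. a < b \<Longrightarrow> b \<le> K \<Longrightarrow> r a < r b" "\<And>a b. a < b \<Longrightarrow> b \<le> K \<Longrightarrow> s a < s b"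
    and adj: "\<And>a b. a \<le> K \<Longrightarrow> b \<le> K \<Longrightarrow> M (r a) (s b) \<longleftrightarrow> sun_adj K a b"
    and first: "r 0 < s 0"
  shows False
proof -
  let ?f = "sun_match K" and ?g = "sun_match' K"
  have indep: "\<not> M (r a) (r b)" if "a \<noteq> b" "a \<le> K" "b \<le> K" for a b
  proof -
    have *: "\<not> M (r a) (r b)" if "a < b" "b \<le> K" for a b
      by (rule sun_rays_independent[of K r s]) (use assms that in auto)
    then show ?thesis
      using that sym by (metis linorder_neqE_nat)
  qed
  have rinj: "a = b" if "a \<le> K" "b \<le> K" "r a = r b" for a b
    using mono(1)[of a b] mono(1)[of b a] that by (cases a b rule: linorder_cases) auto
  have sinj: "a = b" if "a \<le> K" "b \<le> K" "s a = s b" for a b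
    using mono(2)[of a b] mono(2)[of b a] that by (cases a b rule: linorder_cases) auto
  have crossing: "a = b"
    if ab: "a \<le> K" "b \<le> K" and "M (r a) (s (?f b))" "M (s (?f a)) (r b)" for a b
  proof (rule ccontr)
    assume "a \<noteq> b"
    then have "?f a \<noteq> ?f b"
      using inj_on_sun_match[of K] ab by (auto simp: inj_on_def)
    moreover have "sun_adj K a (?f b)" "sun_adj K b (?f a)"
      using adj that sym sun_match_le by blast+
    ultimately show False
      using sun_adj_no_square[of K a b "?f a" "?f b"] \<open>a \<noteq> b\<close> K ab sun_match_le sun_adj_match by blast
  qed
  have "\<exists>b<Suc K. {r 0, s (?g 0)} = {r b, s (?f b)}"
  proof (rule exchange[where f = ?f and g = ?g and r = r and s = s])
    show "\<forall>a<Suc K. M (r a) (s (?f a)) \<and> M (r a) (s (?g a))"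
      using K adj sun_match_le sun_adj_match sun_adj_match' by (auto simp: less_Suc_eq_le)
    show "\<forall>a<Suc K. \<forall>b<Suc K. a \<noteq> b \<longrightarrow>
      (M (r a) (r b) \<and> M (s (?f a)) (s (?f b)) \<longrightarrow> r a = s (?f b) \<or> s (?f a) = r b) \<and>
      (M (r a) (s (?f b)) \<and> M (s (?f a)) (r b) \<longrightarrow> r a = r b \<or> s (?f a) = s (?f b))"
      using indep crossing less_Suc_eq_le by metis
  qed (use less bij_betw_sun_match bij_betw_sun_match' in \<open>auto simp: less_Suc_eq_le\<close>)
  then obtain b where b: "b \<le> K" "{r 0, s (?g 0)} = {r b, s (?f b)}"
    by (auto simp: less_Suc_eq_le)
  have fg: "s (?g 0) \<noteq> s (?f 0)"
    using sinj[of "?g 0" "?f 0"] sun_match_neq[of K 0] sun_match_le[of 0 K] K by auto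
  show False
  proof (cases "b = 0")
    case True
    then show False
      using b(2) fg by (auto simp: doubleton_eq_iff)
  next
    \<comment> \<open>The edges may also agree with their ends swapped, as the two families are not
      assumed disjoint; that would make two rays adjacent.\<close>
    case False
    then have "r 0 = s (?f b)"
      using b rinj[of 0 b] by (auto simp: doubleton_eq_iff)
    moreover have "M (r b) (s (?f b))"
      using K b(1) adj[OF b(1) sun_match_le(1)[OF b(1)]] sun_adj_match by simp
    ultimately show False
      using indep[of b 0] False b(1) by simp
  qed
qed

text \<open>Half of a growth step: it adds a column, and with \<open>r\<close> and \<open>s\<close>
  interchanged a row. The new column avoids all earlier rows by the same downward argument as for
  paths.\<close>

lemma extend_lexically:
  assumes mono: "\<And>a b. a < b \<Longrightarrow> b \<le> Suc p \<Longrightarrow> r a < r b" "\<And>a b. a < b \<Longrightarrow> b \<le> Suc p \<Longrightarrow> s a < s b"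
    and less: "\<And>a. a \<le> Suc p \<Longrightarrow> r a < n" "\<And>a. a \<le> Suc p \<Longrightarrow> s a < n"
    and adj: "M (r p) (s (Suc p))" "\<not> M (r (Suc p)) (s (Suc p))"
    and greatest: "\<And>b d. b + 2 \<le> Suc p \<Longrightarrow> s (b + 2) < d \<Longrightarrow> d < n \<Longrightarrow> M (r (b + 1)) d \<Longrightarrow> M (r b) d"
  obtains e where "s (Suc p) < e" "e < n" "M (r (Suc p)) e" "\<And>a. a \<le> p \<Longrightarrow> \<not> M (r a) e"
    "\<And>d. e < d \<Longrightarrow> d < n \<Longrightarrow> M (r (Suc p)) d \<Longrightarrow> M (r p) d"
proof -
  obtain e where e: "s (Suc p) < e" "e < n" "\<not> M (r p) e" "M (r (Suc p)) e"
    and e_greatest: "\<And>d. e < d \<Longrightarrow> d < n \<Longrightarrow> M (r (Suc p)) d \<Longrightarrow> M (r p) d"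
    by (rule lexical_greatest[of "r p" "r (Suc p)" "s (Suc p)"]) (use adj mono less in auto)
  have "\<not> M (r j) e" if "j \<le> p" for j
    using that
  proof (induction rule: inc_induct)
    case (step j)
    show ?case
    proof
      assume "M (r j) e"
      then have "\<exists>d>e. d < n \<and> \<not> M (r j) d \<and> M (r (Suc j)) d"
        using step mono(1)[of j "Suc j"] less(1)[of "Suc j"] e by (intro lexical) auto
      then obtain d where "e < d" "d < n" "\<not> M (r j) d" "M (r (j + 1)) d"
        by auto
      moreover have "s (j + 2) < d"
        using mono(2)[of "j + 2" "Suc p"] e \<open>e < d\<close> step by (cases "j + 2 = Suc p") auto
      ultimately show False
        using greatest[of j d] step by auto
    qed
  qed (use e in auto)
  then show ?thesis
    using that e e_greatest by blast
qed

text \<open>Lubiw's argument for doubly lexical orderings: from a forbidden submatrix with rows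
  \<open>i, j\<close> and columns \<open>k, l\<close> one grows a staircase of rows and columns, which would have to
  close up to a sun.\<close>

theorem strong_elimination:
  assumes "i < j" "j < k" "k < l" "l < n" "M i k" "M i l" "M j k"
  shows "M j l"
proof (rule ccontr)
  assume "\<not> M j l"
  \<comment> \<open>The adjacency clause is \<open>sun_adj\<close> without the closing corner
    \<open>a = b = K\<close>. \<open>r 0 < s 0\<close> is carried along because
    \<open>sun_rays_independent\<close> starts from it; the last two clauses record the maximality
    of the columns and of the rows.\<close>
  define stairs where "stairs = (\<lambda>(r :: nat \<Rightarrow> nat) (s :: nat \<Rightarrow> nat) p. r 0 < s 0 \<and>
    (\<forall>a\<le>Suc p. r a < n \<and> s a < n) \<and> (\<forall>a b. a < b \<and> b \<le> Suc p \<longrightarrow> r a < r b \<and> s a < s b) \<and>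
    (\<forall>a b. a \<le> Suc p \<and> b \<le> Suc p \<longrightarrow> (M (r a) (s b) \<longleftrightarrow> a = b + 1 \<or> b = a + 1 \<or> (a = 0 \<and> b = 0))) \<and>
    (\<forall>b d. b + 2 \<le> Suc p \<and> s (b + 2) < d \<and> d < n \<and> M (r (b + 1)) d \<longrightarrow> M (r b) d) \<and>
    (\<forall>b d. b + 2 \<le> Suc p \<and> r (b + 2) < d \<and> d < n \<and> M (s (b + 1)) d \<longrightarrow> M (s b) d))"
  have start: "\<exists>r s. stairs r s 0"
  proof -
    define r where "r = (\<lambda>a::nat. if a = 0 then i else j)"
    define s where "s = (\<lambda>a::nat. if a = 0 then k else l)"
    have le1: "a \<le> Suc 0 \<longleftrightarrow> a = 0 \<or> a = 1" for a
      by auto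
    have "stairs r s 0"
      unfolding stairs_def le1 r_def s_def using assms \<open>\<not> M j l\<close> by auto
    then show ?thesis by blast
  qed
  have step: "\<exists>r s. stairs r s (Suc p)" if st: "stairs r s p" for r s p
  proof -
    have first: "r 0 < s 0" and less: "\<And>a. a \<le> Suc p \<Longrightarrow> r a < n" "\<And>a. a \<le> Suc p \<Longrightarrow> s a < n"
      and mono: "\<And>a b. a < b \<Longrightarrow> b \<le> Suc p \<Longrightarrow> r a < r b" "\<And>a b. a < b \<Longrightarrow> b \<le> Suc p \<Longrightarrow> s a < s b"
      and adj: "\<And>a b. a \<le> Suc p \<Longrightarrow> b \<le> Suc p \<Longrightarrow>
        M (r a) (s b) \<longleftrightarrow> a = b + 1 \<or> b = a + 1 \<or> (a = 0 \<and> b = 0)"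
      and great: "\<And>b d. b + 2 \<le> Suc p \<Longrightarrow> s (b + 2) < d \<Longrightarrow> d < n \<Longrightarrow> M (r (b + 1)) d \<Longrightarrow> M (r b) d"
      "\<And>b d. b + 2 \<le> Suc p \<Longrightarrow> r (b + 2) < d \<Longrightarrow> d < n \<Longrightarrow> M (s (b + 1)) d \<Longrightarrow> M (s b) d"
      using st unfolding stairs_def by blast+
    have adj': "M (r p) (s (Suc p))" "\<not> M (r (Suc p)) (s (Suc p))"
      "M (s p) (r (Suc p))" "\<not> M (s (Suc p)) (r (Suc p))"
      using adj[of p "Suc p"] adj[of "Suc p" "Suc p"] adj[of "Suc p" p] sym by auto
    obtain e where e: "s (Suc p) < e" "e < n" "M (r (Suc p)) e" "\<And>a. a \<le> p \<Longrightarrow> \<not> M (r a) e"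
      "\<And>d. e < d \<Longrightarrow> d < n \<Longrightarrow> M (r (Suc p)) d \<Longrightarrow> M (r p) d"
      using extend_lexically[of p r s, OF mono less adj'(1,2) great(1)] by blast
    obtain e' where e': "r (Suc p) < e'" "e' < n" "M (s (Suc p)) e'" "\<And>a. a \<le> p \<Longrightarrow> \<not> M (s a) e'"
      "\<And>d. e' < d \<Longrightarrow> d < n \<Longrightarrow> M (s (Suc p)) d \<Longrightarrow> M (s p) d"
      using extend_lexically[of p s r, OF mono(2,1) less(2,1) adj'(3,4) great(2)] by blast
    define r' where "r' = r(Suc (Suc p) := e')"
    define s' where "s' = s(Suc (Suc p) := e)"
    have old: "r' a = r a" "s' a = s a" if "a \<le> Suc p" for a
      using that by (simp_all add: r'_def s'_def)
    have new: "r' (Suc (Suc p)) = e'" "s' (Suc (Suc p)) = e"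
      by (simp_all add: r'_def s'_def)
    have less': "r' a < n" "s' a < n" if "a \<le> Suc (Suc p)" for a
      using that less[of a] e e' old[of a] new by (cases "a = Suc (Suc p)"; simp)+
    have mono': "r' a < r' b" "s' a < s' b" if "a < b" "b \<le> Suc (Suc p)" for a b
    proof -
      have "r a \<le> r (Suc p)" "s a \<le> s (Suc p)"
        using mono[of a "Suc p"] that by (cases "a = Suc p"; simp)+
      then show "r' a < r' b" "s' a < s' b"
        using that mono[of a b] e e' old[of a] old[of b] new by (cases "b = Suc (Suc p)"; simp)+
    qed
    have adj'': "M (r' a) (s' b) \<longleftrightarrow> a = b + 1 \<or> b = a + 1 \<or> (a = 0 \<and> b = 0) \<or>
        (a = Suc (Suc p) \<and> b = Suc (Suc p) \<and> M e' e)"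
      if ab: "a \<le> Suc (Suc p)" "b \<le> Suc (Suc p)" for a b
    proof -
      consider "a \<le> Suc p" "b \<le> Suc p" | "a = Suc (Suc p)" "b = Suc (Suc p)"
        | "a \<le> p" "b = Suc (Suc p)" | "a = Suc p" "b = Suc (Suc p)"
        | "a = Suc (Suc p)" "b \<le> p" | "a = Suc (Suc p)" "b = Suc p"
        using ab by linarith
      then show ?thesis
      proof cases
        case 1
        then show ?thesis using adj[of a b] old by auto
      next
        case 2
        then show ?thesis using new by simp
      next
        case 3
        then show ?thesis using new old e(4)[of a] by auto
      next
        case 4
        then show ?thesis using new old e(3) by auto
      next
        case 5
        then show ?thesis using new old e'(4)[of b] sym by auto
      next
        case 6
        then show ?thesis using new old e'(3) sym by auto
      qed
    qed
    have first': "r' 0 < s' 0"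
      using first old[of 0] by simp
    \<comment> \<open>Only the new corner is undecided: an entry there closes the staircase to a sun
      with \<open>K = p + 2\<close>, and its absence gives the next staircase.\<close>
    have "\<not> M e' e"
    proof
      assume "M e' e"
      then show False
        using adj'' by (intro no_sun[of "Suc (Suc p)" r' s'] less' mono' first') (auto simp: sun_adj_def)
    qed
    moreover have "M (r' b) d"
      if "b + 2 \<le> Suc (Suc p)" "s' (b + 2) < d" "d < n" "M (r' (b + 1)) d" for b d
      using that great(1)[of b d] e(5)[of d] old[of b] old[of "b + 1"] old[of "b + 2"] new
      by (cases "b = p") auto
    moreover have "M (s' b) d"
      if "b + 2 \<le> Suc (Suc p)" "r' (b + 2) < d" "d < n" "M (s' (b + 1)) d" for b d
      using that great(2)[of b d] e'(5)[of d] old[of b] old[of "b + 1"] old[of "b + 2"] new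
      by (cases "b = p") auto
    ultimately have "stairs r' s' (Suc p)"
      unfolding stairs_def using first' less' mono' adj'' by blast
    then show ?thesis by blast
  qed
  have "\<exists>r s. stairs r s p" for p
    using start step by (induction p) blast+
  then obtain r s where "stairs r s n" by blast
  then have r: "\<And>a. a \<le> Suc n \<Longrightarrow> r a < n" "\<And>a b. a < b \<Longrightarrow> b \<le> Suc n \<Longrightarrow> r a < r b"
    by (auto simp: stairs_def)
  have "inj_on r {..Suc n}"
    using r(2) by (intro linorder_inj_onI) (auto dest: less_imp_neq)
  moreover have "r ` {..Suc n} \<subseteq> {..<n}"
    using r(1) by auto
  ultimately show False
    using card_inj_on_le[of r "{..Suc n}" "{..<n}"] by simp
qed

end

section \<open>Existence of lexical orderings\<close>

text \<open>The highest differing bit decides, since the bits below \<open>K\<close> add up to less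
  than \<open>2 ^ K\<close>.\<close>

lemma sum_powers_of_two_less:
  fixes A B :: "nat set"
  assumes "finite A" "finite B" "K \<in> B" "K \<notin> A" and eq: "\<And>x. K < x \<Longrightarrow> x \<in> A \<longleftrightarrow> x \<in> B"
  shows "(\<Sum>x\<in>A. 2 ^ x) < (\<Sum>x\<in>B. 2 ^ x :: nat)"
proof -
  let ?H = "{x \<in> B. K < x}"
  have finite_H: "finite ?H" using assms by simp
  have "A \<subseteq> {..<K} \<union> ?H"
  proof
    fix x assume "x \<in> A"
    then show "x \<in> {..<K} \<union> ?H"
      using eq[of x] \<open>K \<notin> A\<close> by (cases x K rule: linorder_cases) auto
  qed
  then have "(\<Sum>x\<in>A. 2 ^ x) \<le> (\<Sum>x\<in>{..<K} \<union> ?H. 2 ^ x :: nat)"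
    using finite_H by (intro sum_mono2) auto
  also have "\<dots> = (\<Sum>x<K. 2 ^ x) + (\<Sum>x\<in>?H. 2 ^ x)"
    using finite_H by (intro sum.union_disjoint) auto
  also have "(\<Sum>x<K. 2 ^ x) < (2 ^ K :: nat)"
    by (induction K) auto
  also have "2 ^ K + (\<Sum>x\<in>?H. 2 ^ x) = (\<Sum>x\<in>insert K ?H. 2 ^ x :: nat)"
    using finite_H by simp
  also have "\<dots> \<le> (\<Sum>x\<in>B. 2 ^ x)"
    using assms by (intro sum_mono2) auto
  finally show ?thesis by simp
qed

lemma digits_less:
  fixes n x y a b :: nat
  assumes "n * a + b < n * x + y" "b < n" "y < n"
  shows "a < x \<or> (a = x \<and> b < y)"
proof -
  have "n * x + y < n * a + b" if "x < a"
  proof -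
    have "n * x + y < n * Suc x" using assms by simp
    also have "\<dots> \<le> n * a" using that by (intro mult_le_mono2) simp
    finally show ?thesis by simp
  qed
  then show ?thesis using assms by (metis linorder_neqE_nat nat_add_left_cancel_less order.asym)
qed

lemma digits_eq: "n * a + b = n * x + y \<Longrightarrow> b < n \<Longrightarrow> y < n \<Longrightarrow> a = x \<and> b = (y::nat)"
  by (metis add.commute add_left_cancel div_mult_self2 div_less add_0 less_nat_zero_code)

text \<open>The ordering whose adjacency matrix, read as a binary number with the last row and the
  last column most significant, is largest: exchanging two vertices that violate the lexical
  condition would enlarge that number.\<close>

theorem lexical_ordering_exists:
  assumes "finite V" and refl: "\<And>v. v \<in> V \<Longrightarrow> adj v v" and sym: "\<And>u v. adj u v \<Longrightarrow> adj v u"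
  obtains os where "distinct os" "set os = V"
    "\<And>a b c. \<lbrakk>a < b; b < length os; c < length os; adj (os ! a) (os ! c); \<not> adj (os ! b) (os ! c)\<rbrakk>
      \<Longrightarrow> \<exists>d>c. d < length os \<and> \<not> adj (os ! a) (os ! d) \<and> adj (os ! b) (os ! d)"
proof -
  define n where "n = card V"
  define L where "L = {os. distinct os \<and> set os = V}"
  \<comment> \<open>Entry \<open>(x, y)\<close> of the matrix becomes bit
    \<open>n * x + y\<close>.\<close>
  define ones where "ones os = {n * x + y | x y. x < n \<and> y < n \<and> adj (os ! x) (os ! y)}" for os
  define val where "val os = (\<Sum>p\<in>ones os. 2 ^ p :: nat)" for os
  have length: "length os = n" if "os \<in> L" for os
    using that distinct_card[of os] by (auto simp: L_def n_def)
  have "L \<subseteq> {os. set os \<subseteq> V \<and> length os = n}"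
    using length by (auto simp: L_def)
  then have finL: "finite L"
    by (rule finite_subset) (rule finite_lists_length_eq[OF assms(1)])
  have neL: "L \<noteq> {}"
    using finite_distinct_list[OF assms(1)] by (auto simp: L_def)
  have fin_ones: "finite (ones os)" for os
  proof -
    have "ones os \<subseteq> (\<lambda>(x, y). n * x + y) ` ({..<n} \<times> {..<n})"
      by (auto simp: ones_def)
    then show ?thesis by (rule finite_subset) auto
  qed
  have ones_iff: "n * x + y \<in> ones os \<longleftrightarrow> adj (os ! x) (os ! y)" if "x < n" "y < n" for os x y
    using that digits_eq[of n x y] by (auto simp: ones_def)
  have "Max (val ` L) \<in> val ` L"
    using finL neL by (intro Max_in) auto
  then obtain os where os: "os \<in> L" and "val os = Max (val ` L)" by auto
  then have max: "val os' \<le> val os" if "os' \<in> L" for os'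
    using finL that by simp
  let ?M = "\<lambda>x y. adj (os ! x) (os ! y)"
  have len: "length os = n" using length os by blast
  have symM: "?M x y \<longleftrightarrow> ?M y x" for x y using sym by blast
  have reflM: "?M x x" if "x < n" for x
    using that refl os len by (auto simp: L_def)
  have "\<exists>d>c. d < n \<and> \<not> ?M a d \<and> ?M b d"
    if abc: "a < b" "b < n" "c < n" "?M a c" "\<not> ?M b c" for a b c
  proof (rule ccontr)
    assume none: "\<not> (\<exists>d>c. d < n \<and> \<not> ?M a d \<and> ?M b d)"
    let ?D = "{d. d < n \<and> ?M a d \<noteq> ?M b d}"
    \<comment> \<open>\<open>k\<close> is the last column in which rows \<open>a\<close> and
      \<open>b\<close> differ; the supposed failure puts the one there into row
      \<open>a\<close>.\<close>
    define k where "k = Max ?D"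
    have finD: "finite ?D" by simp
    have c: "c \<in> ?D" using abc by simp
    have "k \<in> ?D" unfolding k_def using finD c by (intro Max_in) auto
    have "c \<le> k" unfolding k_def using finD c by (rule Max_ge)
    have k: "k < n" "?M a k" "\<not> ?M b k"
      using \<open>k \<in> ?D\<close> \<open>c \<le> k\<close> none abc by (cases "c = k"; auto)+
    have above: "?M a d \<longleftrightarrow> ?M b d" if "k < d" "d < n" for d
    proof (rule ccontr)
      assume "?M a d \<noteq> ?M b d"
      then have "d \<le> k" unfolding k_def using finD that by (intro Max_ge) auto
      then show False using that by simp
    qed
    \<comment> \<open>Column \<open>k\<close> is neither of the two being swapped:
      \<open>?M b b\<close> holds, and \<open>k = a\<close> would force \<open>?M a b\<close>, hence
      \<open>?M b a\<close>.\<close>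
    have "k \<noteq> b" using k reflM abc by auto
    have "k \<noteq> a"
    proof
      assume "k = a"
      then have "?M a b" using above[of b] abc reflM by simp
      then show False using k \<open>k = a\<close> symM by blast
    qed
    define os' where "os' = os[a := os ! b, b := os ! a]"
    have a: "a < n" using abc by simp
    have os': "os' \<in> L"
      using os a abc(2) len by (simp add: L_def os'_def distinct_swap set_swap)
    have nth: "os' ! x = (if x = a then os ! b else if x = b then os ! a else os ! x)" if "x < n" for x
      using that a abc(1,2) len by (simp add: os'_def nth_list_update)
    let ?M' = "\<lambda>x y. adj (os' ! x) (os' ! y)"
    have less: "val os < val os'"
      if pq: "p < n" "q < n" "?M' p q" "\<not> ?M p q"
        and eq: "\<And>x y. x < n \<Longrightarrow> y < n \<Longrightarrow> p < x \<or> (p = x \<and> q < y) \<Longrightarrow> ?M' x y \<longleftrightarrow> ?M x y" for p q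
      unfolding val_def
    proof (rule sum_powers_of_two_less)
      show "n * p + q \<in> ones os'" "n * p + q \<notin> ones os"
        using pq ones_iff by auto
      fix z assume z: "n * p + q < z"
      have "\<exists>x y. x < n \<and> y < n \<and> z = n * x + y" if "z \<in> ones os \<or> z \<in> ones os'"
        using that by (auto simp: ones_def)
      then show "z \<in> ones os \<longleftrightarrow> z \<in> ones os'"
        using eq digits_less[of n p q] z pq(2) ones_iff by blast
    qed (simp_all add: fin_ones)
    \<comment> \<open>The swap permutes rows and columns alike. The highest changed bit is
      \<open>(k, b)\<close> or \<open>(b, k)\<close>, whichever has the larger row, and it turns
      from 0 to 1.\<close>
    have "val os < val os'"
    proof (cases "b < k")
      case True
      show ?thesis
      proof (rule less[of k b])
        show "?M' k b" "\<not> ?M k b"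
          using True k abc a symM \<open>k \<noteq> a\<close> nth by auto
        show "?M' x y \<longleftrightarrow> ?M x y" if "x < n" "y < n" "k < x \<or> (k = x \<and> b < y)" for x y
          using that True abc above[of x] symM[of x a] symM[of x b] \<open>k \<noteq> a\<close> nth
          by (cases "y = a"; cases "y = b") auto
      qed (use k abc in auto)
    next
      case False
      then have kb: "k < b" using \<open>k \<noteq> b\<close> by simp
      show ?thesis
      proof (rule less[of b k])
        show "?M' b k" "\<not> ?M b k"
          using k abc a kb \<open>k \<noteq> a\<close> nth by auto
        show "?M' x y \<longleftrightarrow> ?M x y" if xy: "x < n" "y < n" "b < x \<or> (b = x \<and> k < y)" for x y
          using xy(3)
        proof
          assume "b < x"
          then show ?thesis
            using xy kb abc above[of x] symM[of x a] symM[of x b] nth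
            by (cases "y = a"; cases "y = b") auto
        next
          assume "b = x \<and> k < y"
          then show ?thesis
            using xy abc a above[of y] symM[of a b] reflM[of a] reflM[of b] nth
            by (cases "y = a"; cases "y = b") auto
        qed
      qed (use k abc in auto)
    qed
    then show False using max[OF os'] by simp
  qed
  then show ?thesis
    using that[of os] os len by (auto simp: L_def)
qed

section \<open>The quadratic Groebner basis\<close>

lemma rank_less:
  fixes a b c d N :: nat
  assumes "a \<le> c" "b \<le> d" "a < c \<or> b < d" "0 < N"
  shows "a * N + b < c * N + d"
  using assms by (metis add_le_less_mono add_less_le_mono mult_le_mono1 mult_less_mono1)

context looped_graph
begin

lemma reduced_add: "s \<in> monomials m \<Longrightarrow> reduced r (s + t) \<Longrightarrow> reduced r t"
  unfolding reduced_def by (metis add.left_commute monomials_add_iff)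

text \<open>Exchange condition: \<open>il\<close>, \<open>jk\<close> may be replaced by \<open>ik\<close>, \<open>jl\<close> whenever
  \<open>ik\<close> is an edge and \<open>i\<close>, \<open>k\<close> precede \<open>j\<close>, \<open>l\<close>. Making the variable of \<open>ik\<close>
  smallest in a reverse lexicographic order, every such move decreases the monomial, and
  a monomial admitting no such move can be read off greedily from its vertex degrees.\<close>

theorem exchange_order_imp_groebner_basis:
  fixes pos :: "'v \<Rightarrow> nat"
  assumes pos: "inj_on pos V"
    and exchange: "\<And>i j k l. \<lbrakk>pos i < pos j; pos k < pos l; adj i k; adj i l; adj j k\<rbrakk> \<Longrightarrow> adj j l"
  shows "has_quadratic_groebner_basis m (fiber_ideal :: ('k::field) mpoly_nat set)"
proof -
  \<comment> \<open>\<open>N\<close> exceeds every position, so \<open>rk\<close> reads the sorted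
    pair of positions as two digits, the smaller position in front, and is injective.\<close>
  define N where "N = Suc (Max (insert 0 (pos ` V)))"
  define rk where "rk x = Min (pos ` set_mset (em x)) * N + Max (pos ` set_mset (em x))" for x
  have posN: "pos v < N" if "v \<in> V" for v
    unfolding N_def using that finite_V by (auto intro!: le_imp_less_Suc Max_ge)
  have rk_evar: "rk (evar u v) = min (pos u) (pos v) * N + max (pos u) (pos v)" if "adj u v" for u v
    using evar(2)[OF that] by (simp add: rk_def)
  have rk_inj: "inj_on rk {..<m}"
  proof (rule inj_onI)
    fix x y assume "x \<in> {..<m}" "y \<in> {..<m}" and eq: "rk x = rk y"
    then obtain u v u' v' where x: "adj u v" "x = evar u v" and y: "adj u' v'" "y = evar u' v'"
      by (metis evar_cases lessThan_iff)
    have V: "u \<in> V" "v \<in> V" "u' \<in> V" "v' \<in> V" using x y by (auto simp: adj_def)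
    have "N * min (pos u) (pos v) + max (pos u) (pos v) =
        N * min (pos u') (pos v') + max (pos u') (pos v')"
      using eq x y rk_evar by (simp add: mult.commute)
    then have "min (pos u) (pos v) = min (pos u') (pos v') \<and> max (pos u) (pos v) = max (pos u') (pos v')"
      using posN V by (intro digits_eq[of N]) auto
    then have "(pos u = pos u' \<and> pos v = pos v') \<or> (pos u = pos v' \<and> pos v = pos u')"
      by (auto simp: min_def max_def split: if_splits)
    then have "(u = u' \<and> v = v') \<or> (u = v' \<and> v = u')"
      using pos V by (auto simp: inj_on_def)
    then show "x = y" using x y evar_commute by auto
  qed
  define xs where "xs = sort_key rk [0..<m]"
  have set_xs: "set xs = {..<m}" by (auto simp: xs_def)
  have "sorted (map rk xs)" by (simp add: xs_def)
  moreover have "distinct (map rk xs)"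
    using rk_inj set_xs by (simp add: distinct_map xs_def)
  ultimately have "sorted_wrt (<) (map rk xs)"
    by (simp add: strict_sorted_iff)
  then have sorted_xs: "sorted_wrt (\<lambda>x y. rk x < rk y) xs"
    by (simp add: sorted_wrt_map)
  define r where "r = revlex_order m xs"
  have r: "monomial_order m r"
    unfolding r_def by (rule monomial_order_revlex) (rule set_xs)
  have no_move: False
    if red: "reduced r (emon i l + emon j k + t)" and t: "t \<in> monomials m"
      and less: "pos i < pos j" "pos k < pos l"
      and ik: "adj i k" and il: "adj i l" and jk: "adj j k" for i j k l t
  proof -
    have jl: "adj j l" using exchange less ik il jk by blast
    let ?a = "emon i l + emon j k" and ?b = "emon i k + emon j l"
    have N: "0 < N" by (simp add: N_def)
    \<comment> \<open>Passing from \<open>ik\<close> to any of the other three pairs lowers neither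
      digit of the sorted pair and raises at least one.\<close>
    have rk: "rk (evar i k) < rk (evar i l)" "rk (evar i k) < rk (evar j k)"
      "rk (evar i k) < rk (evar j l)"
      unfolding rk_evar[OF ik] rk_evar[OF il] rk_evar[OF jk] rk_evar[OF jl]
      using less by (intro rank_less N; auto simp: min_def max_def)+
    have lookup: "Poly_Mapping.lookup ?a x = 0" if "rk x \<le> rk (evar i k)" for x
      using rk that by (auto simp: emon_def lookup_add lookup_single when_def)
    have lookup_b: "Poly_Mapping.lookup ?b x = 0" if "rk x < rk (evar i k)" for x
      using rk that by (auto simp: emon_def lookup_add lookup_single when_def)
    have pos_b: "0 < Poly_Mapping.lookup ?b (evar i k)"
      by (simp add: emon_def lookup_add)
    have "(?b, ?a) \<in> r"
      unfolding r_def
    proof (rule revlex_orderI[OF _ _ _ sorted_xs])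
      show "evar i k \<in> set xs" using evar(1)[OF ik] set_xs by simp
      show "Poly_Mapping.lookup ?a (evar i k) < Poly_Mapping.lookup ?b (evar i k)"
        using lookup[of "evar i k"] pos_b by simp
    qed (use lookup lookup_b ik il jk jl in auto)
    moreover have "?a \<noteq> ?b"
      using lookup[of "evar i k"] pos_b by auto
    moreover have "W ?a = W ?b"
      using ik il jk jl by (simp add: W_plus add_mset_commute)
    moreover have "?a \<in> monomials m" "?b \<in> monomials m" "monom_degree ?a = 2"
      using ik il jk jl by auto
    ultimately show False
      using red t unfolding reduced_def by blast
  qed
  \<comment> \<open>The first vertex \<open>i\<close> must be joined to its first possible partner
    \<open>k\<close>; a loop is possible only if \<open>i\<close> occurs twice. Otherwise
    \<open>u\<close> contains some \<open>il\<close> and \<open>kj\<close> with \<open>i\<close>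
    before \<open>j\<close> and \<open>k\<close> before \<open>l\<close>, which is a forbidden
    move.\<close>
  have greedy: "\<exists>t\<in>monomials m. u = emon i k + t"
    if u: "u \<in> monomials m" "reduced r u" and i: "i \<in># W u" "\<And>v. v \<in># W u \<Longrightarrow> pos i \<le> pos v"
      and k: "adj i k" "k \<in># W u" "k = i \<Longrightarrow> 2 \<le> count (W u) i"
      and least: "\<And>k'. adj i k' \<Longrightarrow> k' \<in># W u \<Longrightarrow> (k' = i \<Longrightarrow> 2 \<le> count (W u) i) \<Longrightarrow> pos k \<le> pos k'"
    for u i k
  proof (rule ccontr)
    assume no: "\<not> ?thesis"
    obtain l u1 where l: "adj i l" "u1 \<in> monomials m" "u = emon i l + u1"
      using split_emon[OF u(1) i(1)] .
    have W: "W u = {#i, l#} + W u1" using l by (simp add: W_plus)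
    have "l \<noteq> k" using no l by blast
    have "pos k \<le> pos l"
      using W by (intro least l(1)) auto
    then have kl: "pos k < pos l"
      using \<open>l \<noteq> k\<close> pos k(1) l(1) by (metis adj_def inj_onD le_neq_implies_less)
    \<comment> \<open>For \<open>k = i\<close> this uses the second copy of
      \<open>i\<close>.\<close>
    have "k \<in># W u1"
      using k W \<open>l \<noteq> k\<close> by (cases "k = i") (auto simp: not_in_iff)
    then obtain j u2 where j: "adj k j" "u2 \<in> monomials m" "u1 = emon k j + u2"
      using split_emon[OF l(2)] by blast
    have "j \<noteq> i"
    proof
      assume "j = i"
      then have "u = emon i k + (emon i l + u2)"
        using l j by (simp add: emon_commute add.left_commute)
      then show False using no l(1) j(2) by auto
    qed
    moreover have "pos i \<le> pos j"
      using W j by (intro i(2)) (simp add: W_plus)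
    ultimately have ij: "pos i < pos j"
      using pos j(1) l(1) by (metis adj_def inj_onD le_neq_implies_less)
    have "reduced r (emon i l + emon j k + u2)"
      using u(2) l j by (simp add: add.assoc emon_commute)
    then show False
      using no_move[OF _ j(2) ij kl k(1) l(1)] j(1) adj_sym by blast
  qed
  have "u = v" if "u \<in> monomials m" "v \<in> monomials m" "W u = W v" "reduced r u" "reduced r v" for u v
    using that
  proof (induction "monom_degree u" arbitrary: u v rule: less_induct)
    case less
    show ?case
    proof (cases "W u = {#}")
      case True
      then have "monom_degree u = 0" "monom_degree v = 0"
        using W_size[of u] W_size[of v] less.prems by auto
      then show ?thesis by simp
    next
      case False
      define i where "i = arg_min_on pos (set_mset (W u))"
      have i: "i \<in># W u" "\<And>v. v \<in># W u \<Longrightarrow> pos i \<le> pos v"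
        using arg_min_if_finite[of "set_mset (W u)" pos] False unfolding i_def
        by (auto simp: not_less)
      \<comment> \<open>\<open>C\<close> depends on \<open>u\<close> only through
        \<open>W u\<close>, so the same edge \<open>ik\<close> splits off from
        \<open>v\<close>.\<close>
      define C where "C = {k \<in> set_mset (W u). adj i k \<and> (k = i \<longrightarrow> 2 \<le> count (W u) i)}"
      obtain l u1 where l: "adj i l" "u1 \<in> monomials m" "u = emon i l + u1"
        using split_emon[OF less.prems(1) i(1)] .
      have "l \<in> C"
        using l by (auto simp: C_def W_plus)
      then have neC: "C \<noteq> {}" by auto
      have finC: "finite C" by (simp add: C_def)
      define k where "k = arg_min_on pos C"
      have k: "k \<in> C" "\<And>k'. k' \<in> C \<Longrightarrow> pos k \<le> pos k'"
        using arg_min_if_finite[OF finC neC, of pos] unfolding k_def by (auto simp: not_less)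
      have ik: "adj i k" using k(1) by (simp add: C_def)
      have "\<exists>t\<in>monomials m. u = emon i k + t"
        by (rule greedy) (use less.prems i k in \<open>auto simp: C_def\<close>)
      then obtain u' where u': "u' \<in> monomials m" "u = emon i k + u'" by auto
      have "\<exists>t\<in>monomials m. v = emon i k + t"
        by (rule greedy) (use less.prems i k in \<open>auto simp: C_def\<close>)
      then obtain v' where v': "v' \<in> monomials m" "v = emon i k + v'" by auto
      have "u' = v'"
      proof (rule less.hyps)
        show "monom_degree u' < monom_degree u" using u' by simp
        show "W u' = W v'" using less.prems(3) u' v' by (simp add: W_plus)
        show "reduced r u'" "reduced r v'"
          using less.prems(4,5) u' v' ik reduced_add emon_monomials by metis+
      qed (use u' v' in auto)
      then show ?thesis using u' v' by simp
    qed
  qed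
  then show ?thesis
    using unique_reduced_imp_groebner_basis[OF r] by blast
qed

text \<open>A lexical ordering exists in any case; quadratic generation supplies
  \<open>exchange\<close> for its matrix, where injectivity of the ordering carries equal edges back
  to equal positions.\<close>

theorem generated_imp_strong_elimination:
  assumes gen: "generated_by_quadratic_binomials m (fiber_ideal :: ('k::field) mpoly_nat set)"
  obtains os where "distinct os" "set os = V"
    "\<And>a b c. \<lbrakk>a < b; a < c; b < length os; c < length os; adj (os ! a) (os ! b);
      adj (os ! a) (os ! c)\<rbrakk>
      \<Longrightarrow> adj (os ! b) (os ! c)"
    "\<And>i j k l. \<lbrakk>i < j; j < k; k < l; l < length os; adj (os ! i) (os ! k); adj (os ! i) (os ! l);
      adj (os ! j) (os ! k)\<rbrakk> \<Longrightarrow> adj (os ! j) (os ! l)"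
proof -
  obtain os where os: "distinct os" "set os = V"
    and lex: "\<And>a b c. \<lbrakk>a < b; b < length os; c < length os; adj (os ! a) (os ! c);
      \<not> adj (os ! b) (os ! c)\<rbrakk>
      \<Longrightarrow> \<exists>d>c. d < length os \<and> \<not> adj (os ! a) (os ! d) \<and> adj (os ! b) (os ! d)"
    using lexical_ordering_exists[of V adj, OF finite_V adj_refl adj_sym] by blast
  interpret lexical_matrix "length os" "\<lambda>a b. adj (os ! a) (os ! b)"
  proof
    fix f g :: "nat \<Rightarrow> nat" and r s :: "nat \<Rightarrow> nat" and k j
    assume *: "bij_betw f {..<k} {..<k}" "bij_betw g {..<k} {..<k}"
      and rs: "\<forall>a<k. r a < length os \<and> s a < length os"
      and edges: "\<forall>a<k. adj (os ! r a) (os ! s (f a)) \<and> adj (os ! r a) (os ! s (g a))"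
      and moves: "\<forall>a<k. \<forall>b<k. a \<noteq> b \<longrightarrow>
        (adj (os ! r a) (os ! r b) \<and> adj (os ! s (f a)) (os ! s (f b)) \<longrightarrow> r a = s (f b) \<or> s (f a) = r b) \<and>
        (adj (os ! r a) (os ! s (f b)) \<and> adj (os ! s (f a)) (os ! r b) \<longrightarrow> r a = r b \<or> s (f a) = s (f b))"
      and j: "j < k"
    have fg: "f a < k" "g a < k" if "a < k" for a
      using * that by (auto simp: bij_betw_def)
    have "\<exists>b<k. {os ! r j, os ! s (g j)} = {os ! r b, os ! s (f b)}"
      by (rule generated_imp_exchange[OF gen *, of "\<lambda>a. os ! r a" "\<lambda>a. os ! s a"])
        (use edges moves j in \<open>metis\<close>)+
    then obtain b where b: "b < k" "{os ! r j, os ! s (g j)} = {os ! r b, os ! s (f b)}" by blast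
    then have "{r j, s (g j)} = {r b, s (f b)}"
      using rs j fg nth_eq_iff_index_eq[OF os(1)] by (auto simp: doubleton_eq_iff)
    then show "\<exists>b<k. {r j, s (g j)} = {r b, s (f b)}" using b(1) by blast
  qed (use lex adj_refl adj_sym os in auto)
  show ?thesis
    using that[OF os] perfect_elimination strong_elimination by blast
qed

end

section \<open>Strong perfect elimination orderings\<close>

lemma simple_graph_edge_neq: "simple_graph V E \<Longrightarrow> {u, v} \<in> E \<Longrightarrow> u \<noteq> v"
  by (auto simp: simple_graph_def)

lemma in_set_drop_iff: "x \<in> set (drop i xs) \<longleftrightarrow> (\<exists>b. i \<le> b \<and> b < length xs \<and> x = xs ! b)"
proof
  assume "x \<in> set (drop i xs)"
  then obtain j where "j < length xs - i" "x = xs ! (i + j)"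
    by (auto simp: in_set_conv_nth)
  then show "\<exists>b. i \<le> b \<and> b < length xs \<and> x = xs ! b"
    by (intro exI[of _ "i + j"]) auto
next
  assume "\<exists>b. i \<le> b \<and> b < length xs \<and> x = xs ! b"
  then obtain b where "i \<le> b" "b < length xs" "x = xs ! b" by blast
  then show "x \<in> set (drop i xs)"
    by (auto simp: in_set_conv_nth intro!: exI[of _ "b - i"])
qed

lemma perfect_elimination_ordering_iff:
  assumes "simple_graph V E" "distinct vs" "set vs = V"
  shows "perfect_elimination_ordering V E vs \<longleftrightarrow>
    (\<forall>i b c. i < b \<and> i < c \<and> b < length vs \<and> c < length vs \<and> b \<noteq> c \<and>
       {vs ! i, vs ! b} \<in> E \<and> {vs ! i, vs ! c} \<in> E \<longrightarrow> {vs ! b, vs ! c} \<in> E)"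
    (is "?L \<longleftrightarrow> ?R")
proof
  assume L: ?L
  show ?R
  proof (intro allI impI)
    fix i b c
    assume *: "i < b \<and> i < c \<and> b < length vs \<and> c < length vs \<and> b \<noteq> c \<and>
       {vs ! i, vs ! b} \<in> E \<and> {vs ! i, vs ! c} \<in> E"
    have in_drop: "vs ! x \<in> set (drop i vs)" if "i \<le> x" "x < length vs" for x
      using that by (auto simp: in_set_drop_iff)
    have "simplicial (induced_edges E (set (drop i vs))) (vs ! i)"
      using L * by (auto simp: perfect_elimination_ordering_def)
    moreover have "vs ! x \<in> neighbours (induced_edges E (set (drop i vs))) (vs ! i)"
      if "x = b \<or> x = c" for x
      using that * in_drop[of i] in_drop[of x] by (auto simp: neighbours_def induced_edges_def)
    moreover have "vs ! b \<noteq> vs ! c"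
      using * assms(2) by (simp add: nth_eq_iff_index_eq)
    ultimately show "{vs ! b, vs ! c} \<in> E"
      unfolding simplicial_def is_clique_def induced_edges_def by blast
  qed
next
  assume R: ?R
  have "simplicial (induced_edges E (set (drop i vs))) (vs ! i)" for i
    unfolding simplicial_def is_clique_def
  proof (intro ballI impI)
    fix u w
    assume u: "u \<in> neighbours (induced_edges E (set (drop i vs))) (vs ! i)"
      and w: "w \<in> neighbours (induced_edges E (set (drop i vs))) (vs ! i)" and "u \<noteq> w"
    have later: "\<exists>b. i < b \<and> b < length vs \<and> x = vs ! b \<and> {vs ! i, vs ! b} \<in> E"
      if "x \<in> neighbours (induced_edges E (set (drop i vs))) (vs ! i)" for x
    proof -
      have x: "{vs ! i, x} \<in> E" "x \<in> set (drop i vs)"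
        using that by (auto simp: neighbours_def induced_edges_def)
      then obtain b where b: "i \<le> b" "b < length vs" "x = vs ! b"
        by (auto simp: in_set_drop_iff)
      have "b \<noteq> i" using x b simple_graph_edge_neq[OF assms(1)] by auto
      then show ?thesis using b x by (intro exI[of _ b]) auto
    qed
    obtain b c where "i < b" "b < length vs" "u = vs ! b" "{vs ! i, vs ! b} \<in> E"
      "i < c" "c < length vs" "w = vs ! c" "{vs ! i, vs ! c} \<in> E"
      using later[OF u] later[OF w] by blast
    then have "{u, w} \<in> E" using R \<open>u \<noteq> w\<close> by blast
    moreover have "u \<in> set (drop i vs)" "w \<in> set (drop i vs)"
      using u w by (auto simp: neighbours_def induced_edges_def)
    ultimately show "{u, w} \<in> induced_edges E (set (drop i vs))"
      by (simp add: induced_edges_def)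
  qed
  then show ?L
    using assms by (simp add: perfect_elimination_ordering_def)
qed

text \<open>The definition speaks only of \<open>i < j < k < l\<close> and of proper edges. Perfect
  elimination covers the positions in which a row index meets or passes a column index, and symmetry
  of the matrix allows rows and columns to change roles.\<close>

lemma strong_perfect_elimination_exchange:
  assumes G: "simple_graph V E" and spe: "strong_perfect_elimination_ordering V E vs"
    and "i < j" "k < l" "j < length vs" "l < length vs"
    and ik: "i = k \<or> {vs ! i, vs ! k} \<in> E" and il: "i = l \<or> {vs ! i, vs ! l} \<in> E"
    and jk: "j = k \<or> {vs ! j, vs ! k} \<in> E"
  shows "j = l \<or> {vs ! j, vs ! l} \<in> E"
proof -
  have vs: "distinct vs" "set vs = V" and peo: "perfect_elimination_ordering V E vs"
    using spe by (auto simp: strong_perfect_elimination_ordering_def perfect_elimination_ordering_def)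
  define A where "A a b \<longleftrightarrow> a = b \<or> {vs ! a, vs ! b} \<in> E" for a b
  have A_sym: "A a b \<Longrightarrow> A b a" for a b by (auto simp: A_def insert_commute)
  have pe: "A b c" if "a < b" "a < c" "b < length vs" "c < length vs" "A a b" "A a c" for a b c
    using peo[unfolded perfect_elimination_ordering_iff[OF G vs]] that unfolding A_def by blast
  have strong: "A b d" if "a < b" "b < c" "c < d" "d < length vs" "A a c" "A a d" "A b c" for a b c d
  proof -
    have "a \<noteq> c" "a \<noteq> d" "b \<noteq> c" using that(1-3) by auto
    then show ?thesis
      using spe that unfolding strong_perfect_elimination_ordering_def A_def by blast
  qed
  have main: "A j l" if "i < k" "i < j" "k < l" "j < length vs" "l < length vs" "A i k" "A i l" "A j k"
    for i j k l
  proof (cases j k rule: linorder_cases)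
    case less
    then show ?thesis using strong[of i j k l] that by blast
  next
    case equal
    then show ?thesis using pe[of i k l] that by auto
  next
    \<comment> \<open>\<open>i\<close> joins \<open>k\<close> to \<open>l\<close>; then
      \<open>k\<close>, which precedes both, joins \<open>j\<close> to \<open>l\<close>.\<close>
    case greater
    then have "A k l" using pe[of i k l] that by auto
    then show ?thesis using pe[of k j l] that greater A_sym by auto
  qed
  have "A j l"
  proof (cases i k rule: linorder_cases)
    case less
    then show ?thesis using main[of i k j l] assms by (auto simp: A_def)
  next
    case equal
    then show ?thesis using pe[of i j l] assms A_sym by (auto simp: A_def insert_commute)
  next
    case greater
    \<comment> \<open>The transposed instance, with columns acting as rows. The arguments of
      \<open>main\<close> come in the order \<open>i k j l\<close> of first occurrence.\<close>
    then have "A l j" using main[of k i l j] assms A_sym by (auto simp: A_def insert_commute)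
    then show ?thesis by (rule A_sym)
  qed
  then show ?thesis by (simp add: A_def)
qed

section \<open>The toric ideal of the extended incidence matrix\<close>

text \<open>\<open>nat\<close> cuts negative entries to 0, so \<open>b\<close> and \<open>-b\<close>
  give the two terms of the toric binomial.\<close>

definition vec_monom :: "nat \<Rightarrow> (nat \<Rightarrow> int) \<Rightarrow> monom_nat" where
  "vec_monom m b = (\<Sum>x<m. Poly_Mapping.single x (nat (b x)))"

lemma lookup_vec_monom:
  "Poly_Mapping.lookup (vec_monom m b) x = (if x < m then nat (b x) else 0)"
  by (simp add: vec_monom_def lookup_sum lookup_single when_def)

lemma vec_monom_monomials [simp]: "vec_monom m b \<in> monomials m"
  by (auto simp: monomials_def in_keys_iff lookup_vec_monom split: if_splits)

lemma mpoly_var_power: "mpoly_var x ^ k = mpoly_monom (Poly_Mapping.single x k)"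
proof (induction k)
  case 0
  then show ?case by (simp add: mpoly_monom_def)
next
  case (Suc k)
  then show ?case
    by (simp add: mpoly_var_def mpoly_monom_def mult_single flip: Poly_Mapping.single_add)
qed

lemma prod_mpoly_monom:
  "(\<Prod>x\<in>A. mpoly_monom (h x)) = (mpoly_monom (\<Sum>x\<in>A. h x) :: ('k::field) mpoly_nat)"
proof (induction A rule: infinite_finite_induct)
  case (insert x A)
  then show ?case by (simp add: mpoly_monom_add)
qed (simp_all add: mpoly_monom_def)

lemma toric_binomial_eq:
  assumes "b \<in> carrier_vec m"
  shows "toric_binomial b =
    (mpoly_monom (vec_monom m (\<lambda>x. b $ x)) - mpoly_monom (vec_monom m (\<lambda>x. - b $ x))
      :: ('k::field) mpoly_nat)"
proof -
  have *: "(\<Prod>i\<in>{i. i < m \<and> 0 < h i}. mpoly_var i ^ nat (h i)) =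
      (mpoly_monom (vec_monom m h) :: 'k mpoly_nat)"
    for h :: "nat \<Rightarrow> int"
  proof -
    have "(\<Sum>x\<in>{i. i < m \<and> 0 < h i}. Poly_Mapping.single x (nat (h x))) = vec_monom m h"
      unfolding vec_monom_def
      by (rule sum.mono_neutral_left) (auto, metis nat_0_iff not_less single_zero)
    then show ?thesis by (simp add: mpoly_var_power prod_mpoly_monom)
  qed
  show ?thesis
    using *[of "\<lambda>x. b $ x"] *[of "\<lambda>x. - b $ x"] assms by (simp add: toric_binomial_def)
qed

text \<open>Column \<open>x\<close> of the matrix as a multiset: the first columns come from
  \<open>2E_n\<close>, so their vertex is doubled; edge indices are shifted by
  \<open>length vs\<close>.\<close>

definition endpoints :: "'v list \<Rightarrow> 'v set list \<Rightarrow> nat \<Rightarrow> 'v multiset" where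
  "endpoints vs es x =
     (if x < length vs then {#vs ! x, vs ! x#} else mset_set (es ! (x - length vs)))"

lemma extended_incidence_matrix_dims [simp]:
  "dim_row (extended_incidence_matrix vs es) = length vs"
  "dim_col (extended_incidence_matrix vs es) = length vs + length es"
  by (simp_all add: extended_incidence_matrix_def incidence_matrix_def)

lemma extended_incidence_matrix_entry:
  assumes "simple_graph V E" "distinct vs" "set es = E" "i < length vs" "x < length vs + length es"
  shows "extended_incidence_matrix vs es $$ (i, x) = int (count (endpoints vs es x) (vs ! i))"
proof (cases "x < length vs")
  case True
  then show ?thesis
    using assms nth_eq_iff_index_eq[OF assms(2) assms(4) True]
    by (auto simp: extended_incidence_matrix_def incidence_matrix_def endpoints_def
        mat_of_cols_index nth_append)
next
  case False
  define y where "y = x - length vs"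
  have y: "y < length es" using assms False by (simp add: y_def)
  have "finite (es ! y)"
    using assms y nth_mem[OF y] by (auto simp: simple_graph_def intro: finite_subset)
  then show ?thesis
    using assms False y
    by (auto simp: extended_incidence_matrix_def incidence_matrix_def endpoints_def
        mat_of_cols_index nth_append simp flip: y_def)
qed

lemma looped_graph_endpoints:
  assumes G: "simple_graph V E" and vs: "distinct vs" "set vs = V" and es: "distinct es" "set es = E"
  shows "looped_graph V E (length vs + length es) (endpoints vs es)"
proof
  let ?n = "length vs" and ?em = "endpoints vs es"
  show "finite V" using G by (simp add: simple_graph_def)
  have edge: "\<exists>u v. u \<noteq> v \<and> u \<in> V \<and> v \<in> V \<and> es ! y = {u, v} \<and> {u, v} \<in> E" if "y < length es" for y
  proof -
    have "es ! y \<in> E" using that es by auto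
    moreover from this have "card (es ! y) = 2" "es ! y \<subseteq> V"
      using G by (auto simp: simple_graph_def)
    moreover from this obtain u v where "es ! y = {u, v}" "u \<noteq> v"
      by (meson card_2_iff)
    ultimately show ?thesis by (metis insert_subset)
  qed
  show "inj_on ?em {..<?n + length es}"
  proof (rule inj_onI)
    fix x y assume xy: "x \<in> {..<?n + length es}" "y \<in> {..<?n + length es}" and eq: "?em x = ?em y"
    have loop: "set_mset (?em z) = {vs ! z}" if "z < ?n" for z
      using that by (simp add: endpoints_def)
    have nonloop: "set_mset (?em z) = es ! (z - ?n)" "card (set_mset (?em z)) = 2"
      if "\<not> z < ?n" "z < ?n + length es" for z
    proof -
      have "z - ?n < length es"
        using that by linarith
      then obtain u v where "u \<noteq> v" "es ! (z - ?n) = {u, v}"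
        using edge by blast
      then show "set_mset (?em z) = es ! (z - ?n)" "card (set_mset (?em z)) = 2"
        using \<open>\<not> z < ?n\<close> by (auto simp: endpoints_def)
    qed
    have set_eq: "set_mset (?em x) = set_mset (?em y)" using eq by simp
    consider "x < ?n" "y < ?n" | "x < ?n" "\<not> y < ?n" | "\<not> x < ?n" "y < ?n" | "\<not> x < ?n" "\<not> y < ?n"
      by blast
    then show "x = y"
    proof cases
      case 1
      then show ?thesis using set_eq loop nth_eq_iff_index_eq[OF vs(1)] by auto
    next
      case 2
      then have "card {vs ! x} = 2" using set_eq loop[of x] nonloop(2)[of y] xy by simp
      then show ?thesis by simp
    next
      case 3
      then have "card {vs ! y} = 2" using set_eq loop[of y] nonloop(2)[of x] xy by simp
      then show ?thesis by simp
    next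
      case 4
      then have "es ! (x - ?n) = es ! (y - ?n)" using set_eq nonloop(1)[of x] nonloop(1)[of y] xy by auto
      then have "x - ?n = y - ?n"
        using 4 xy nth_eq_iff_index_eq[OF es(1), of "x - ?n" "y - ?n"] by auto
      then show ?thesis using 4 by simp
    qed
  qed
  show "?em ` {..<?n + length es} = {{#u, v#} |u v. u \<in> V \<and> v \<in> V \<and> (u = v \<or> {u, v} \<in> E)}" (is "_ = ?S")
  proof (intro equalityI subsetI)
    fix M assume "M \<in> ?em ` {..<?n + length es}"
    then obtain x where x: "x < ?n + length es" "M = ?em x" by auto
    show "M \<in> ?S"
    proof (cases "x < ?n")
      case True
      then have "M = {#vs ! x, vs ! x#}" "vs ! x \<in> V" using x vs by (auto simp: endpoints_def)
      then show ?thesis by blast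
    next
      case False
      then have "x - ?n < length es"
        using x by linarith
      then obtain u v where uv: "u \<noteq> v" "u \<in> V" "v \<in> V" "es ! (x - ?n) = {u, v}" "{u, v} \<in> E"
        using edge by blast
      then have "M = {#u, v#}" using False x by (simp add: endpoints_def)
      then show ?thesis using uv by blast
    qed
  next
    fix M assume "M \<in> ?S"
    then obtain u v where uv: "M = {#u, v#}" "u \<in> V" "v \<in> V" "u = v \<or> {u, v} \<in> E" by blast
    from uv(4) show "M \<in> ?em ` {..<?n + length es}"
    proof
      assume "u = v"
      obtain x where "x < ?n" "vs ! x = u" using uv vs by (auto simp: in_set_conv_nth)
      then show ?thesis
        using uv \<open>u = v\<close> by (intro image_eqI[of _ _ x]) (auto simp: endpoints_def)
    next
      assume e: "{u, v} \<in> E"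
      then have "u \<noteq> v" using simple_graph_edge_neq[OF G] by blast
      obtain y where "y < length es" "es ! y = {u, v}" using e es by (auto simp: in_set_conv_nth)
      then show ?thesis
        using uv \<open>u \<noteq> v\<close> by (intro image_eqI[of _ _ "?n + y"]) (auto simp: endpoints_def)
    qed
  qed
qed

text \<open>Equal multidegree means that the difference of exponents lies in the kernel of the
  matrix. The generators still differ: the terms of a toric binomial share no variable, while those
  of a fiber binomial may.\<close>

lemma toric_ideal_eq_fiber_ideal:
  assumes G: "simple_graph V E" and vs: "distinct vs" "set vs = V" and es: "distinct es" "set es = E"
  shows "toric_ideal (extended_incidence_matrix vs es) =
    (monomial_grading.fiber_ideal (length vs + length es)
      (looped_graph.W (length vs + length es) (endpoints vs es)) :: ('k::field) mpoly_nat set)"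
proof -
  let ?n = "length vs" and ?em = "endpoints vs es" and ?A = "extended_incidence_matrix vs es"
  define m where "m = length vs + length es"
  interpret looped_graph V E m ?em
    unfolding m_def using assms by (rule looped_graph_endpoints)
  let ?T = "{toric_binomial b | b. b \<in> carrier_vec m \<and> ?A *\<^sub>v b = 0\<^sub>v ?n} :: 'k mpoly_nat set"
  have W_eq_iff: "W s = W t \<longleftrightarrow>
      (\<forall>i<?n. (\<Sum>x<m. ?A $$ (i, x) * (int (Poly_Mapping.lookup s x) - int (Poly_Mapping.lookup t x))) = 0)"
    for s t
  proof -
    have count: "(\<Sum>x<m. ?A $$ (i, x) * int (Poly_Mapping.lookup u x)) = int (count (W u) (vs ! i))"
      if "i < ?n" for i u
      using extended_incidence_matrix_entry[OF G vs(1) es(2) that, folded m_def]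
      by (simp add: W_def count_sum mult.commute)
    have "W s = W t \<longleftrightarrow> (\<forall>i<?n. count (W s) (vs ! i) = count (W t) (vs ! i))"
    proof
      assume *: "\<forall>i<?n. count (W s) (vs ! i) = count (W t) (vs ! i)"
      show "W s = W t"
      proof (rule multiset_eqI)
        fix v
        show "count (W s) v = count (W t) v"
        proof (cases "v \<in> V")
          case True
          then show ?thesis using * vs by (auto simp: in_set_conv_nth)
        next
          case False
          then show ?thesis using W_subset_V[of v s] W_subset_V[of v t] by (metis not_in_iff)
        qed
      qed
    qed simp
    also have "\<dots> \<longleftrightarrow> (\<forall>i<?n. int (count (W s) (vs ! i)) - int (count (W t) (vs ! i)) = 0)"
      by simp
    also have "\<dots> \<longleftrightarrow> (\<forall>i<?n. (\<Sum>x<m. ?A $$ (i, x) *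
        (int (Poly_Mapping.lookup s x) - int (Poly_Mapping.lookup t x))) = 0)"
      by (simp add: right_diff_distrib sum_subtractf count)
    finally show ?thesis .
  qed
  have kernel_iff: "?A *\<^sub>v b = 0\<^sub>v ?n \<longleftrightarrow> (\<forall>i<?n. (\<Sum>x<m. ?A $$ (i, x) * b $ x) = 0)"
    if "b \<in> carrier_vec m" for b
    using that by (auto simp: vec_eq_iff scalar_prod_def m_def atLeast0LessThan)
  have T_sub: "?T \<subseteq> fiber_binomials"
  proof
    fix p assume "p \<in> ?T"
    then obtain b where b: "p = toric_binomial b" "b \<in> carrier_vec m" "?A *\<^sub>v b = 0\<^sub>v ?n" by blast
    let ?u = "vec_monom m (\<lambda>x. b $ x)" and ?v = "vec_monom m (\<lambda>x. - b $ x)"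
    have "int (Poly_Mapping.lookup ?u x) - int (Poly_Mapping.lookup ?v x) = b $ x" if "x < m" for x
      using that by (simp add: lookup_vec_monom)
    then have "W ?u = W ?v"
      using b kernel_iff[OF b(2)] unfolding W_eq_iff by simp
    then show "p \<in> fiber_binomials"
      unfolding b(1) toric_binomial_eq[OF b(2)] fiber_binomials_def using vec_monom_monomials by blast
  qed
  then have T_carrier: "?T \<subseteq> carrier (poly_ring m)"
    using fiber_binomials_subset by blast
  have idT: "ideal (genideal (poly_ring m) ?T) (poly_ring m)"
    by (intro ring.genideal_ideal ring_poly_ring T_carrier)
  have "fiber_binomials \<subseteq> genideal (poly_ring m) ?T"
  proof
    fix p :: "'k mpoly_nat" assume "p \<in> fiber_binomials"
    then obtain u v where p: "p = mpoly_monom u - mpoly_monom v"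
      and uv: "u \<in> monomials m" "v \<in> monomials m" "W u = W v"
      by (auto simp: fiber_binomials_def)
    define b where "b = vec m (\<lambda>x. int (Poly_Mapping.lookup u x) - int (Poly_Mapping.lookup v x))"
    have bm: "b \<in> carrier_vec m" by (simp add: b_def)
    let ?u = "vec_monom m (\<lambda>x. b $ x)" and ?v = "vec_monom m (\<lambda>x. - b $ x)"
    \<comment> \<open>\<open>?u\<close> is the positive part of the difference of exponents, so
      \<open>c\<close> is the greatest common divisor of \<open>u\<close> and
      \<open>v\<close>.\<close>
    define c where "c = u - ?u"
    have zero: "Poly_Mapping.lookup u x = 0" "Poly_Mapping.lookup v x = 0" if "\<not> x < m" for x
      using uv that by (auto simp: monomials_def in_keys_iff subset_iff)
    have u: "u = c + ?u"
      by (rule poly_mapping_eqI) (auto simp: c_def b_def lookup_add lookup_minus lookup_vec_monom)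
    have v: "v = c + ?v"
      by (rule poly_mapping_eqI)
        (auto simp: c_def b_def lookup_add lookup_minus lookup_vec_monom zero)
    have cm: "c \<in> monomials m" using uv(1) u monomials_add_iff by metis
    have "?A *\<^sub>v b = 0\<^sub>v ?n"
      unfolding kernel_iff[OF bm] using uv(3)[unfolded W_eq_iff] by (simp add: b_def)
    then have "toric_binomial b \<in> ?T" using bm by blast
    then have "toric_binomial b \<in> genideal (poly_ring m) ?T"
      using ring.genideal_self[OF ring_poly_ring T_carrier] by blast
    then have "mpoly_monom c * toric_binomial b \<in> genideal (poly_ring m) ?T"
      using cm by (intro ideal_poly_ringD(4)[OF idT]) simp_all
    moreover have "p = mpoly_monom c * toric_binomial b"
      unfolding p toric_binomial_eq[OF bm] using u v
      by (metis mpoly_monom_add right_diff_distrib)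
    ultimately show "p \<in> genideal (poly_ring m) ?T" by simp
  qed
  then have "fiber_ideal \<subseteq> genideal (poly_ring m) ?T"
    unfolding fiber_ideal_def by (intro ring.genideal_minimal ring_poly_ring idT)
  moreover have "genideal (poly_ring m) ?T \<subseteq> fiber_ideal"
    unfolding fiber_ideal_def
    by (rule ring.subset_Idl_subset[OF ring_poly_ring fiber_binomials_subset T_sub])
  ultimately have "toric_ideal ?A = (fiber_ideal :: 'k mpoly_nat set)"
    by (auto simp: toric_ideal_def m_def)
  then show ?thesis by (simp add: m_def)
qed

theorem theorem2p2:
  fixes V :: "'v set" and E :: "'v set set" and vs :: "'v list" and es :: "'v set list"
    and I :: "('k::field) mpoly_nat set"
  assumes "simple_graph V E"
    and "distinct vs" and "set vs = V"
    and "distinct es" and "set es = E"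
  defines "I \<equiv> toric_ideal (extended_incidence_matrix vs es)"
  shows "(strongly_chordal V E \<longleftrightarrow>
            has_quadratic_groebner_basis (length vs + length es) I) \<and>
         (has_quadratic_groebner_basis (length vs + length es) I \<longleftrightarrow>
            generated_by_quadratic_binomials (length vs + length es) I)"
proof -
  define m where "m = length vs + length es"
  interpret looped_graph V E m "endpoints vs es"
    unfolding m_def using assms(1-5) by (rule looped_graph_endpoints)
  have I: "I = fiber_ideal"
    unfolding I_def m_def using assms(1-5) by (rule toric_ideal_eq_fiber_ideal)
  have "has_quadratic_groebner_basis m I" if "strongly_chordal V E"
  proof -
    obtain os where os: "strong_perfect_elimination_ordering V E os"
      using \<open>strongly_chordal V E\<close> by (auto simp: strongly_chordal_def)
    then have dist: "distinct os" "set os = V"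
      by (auto simp: strong_perfect_elimination_ordering_def perfect_elimination_ordering_def)
    define pos where "pos = inv_into {..<length os} ((!) os)"
    have img: "(!) os ` {..<length os} = V"
      using dist(2) by (auto simp: set_conv_nth)
    have pos: "pos v < length os" "os ! pos v = v" if "v \<in> V" for v
      using that inv_into_into[of v "(!) os" "{..<length os}"] f_inv_into_f[of v "(!) os" "{..<length os}"]
      unfolding pos_def img by auto
    show ?thesis
      unfolding I
    proof (rule exchange_order_imp_groebner_basis[of pos])
      show "inj_on pos V"
        by (rule inj_onI) (metis pos(2))
      fix i j k l
      assume less: "pos i < pos j" "pos k < pos l" and adj: "adj i k" "adj i l" "adj j k"
      then have V: "i \<in> V" "j \<in> V" "k \<in> V" "l \<in> V" by (auto simp: adj_def)
      have "pos j = pos l \<or> {os ! pos j, os ! pos l} \<in> E"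
        by (rule strong_perfect_elimination_exchange[OF assms(1) os less])
          (use pos V adj in \<open>auto simp: adj_def\<close>)
      then show "adj j l"
        using pos(2) V unfolding adj_def by metis
    qed
  qed
  moreover have "generated_by_quadratic_binomials m I" if "has_quadratic_groebner_basis m I"
    using that unfolding I by (rule groebner_basis_imp_generated)
  moreover have "strongly_chordal V E" if gen: "generated_by_quadratic_binomials m I"
  proof -
    obtain os where os: "distinct os" "set os = V"
      and pe: "\<And>a b c. \<lbrakk>a < b; a < c; b < length os; c < length os; adj (os ! a) (os ! b);
        adj (os ! a) (os ! c)\<rbrakk>
        \<Longrightarrow> adj (os ! b) (os ! c)"
      and strong: "\<And>i j k l. \<lbrakk>i < j; j < k; k < l; l < length os; adj (os ! i) (os ! k);
        adj (os ! i) (os ! l); adj (os ! j) (os ! k)\<rbrakk> \<Longrightarrow> adj (os ! j) (os ! l)"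
      using generated_imp_strong_elimination[OF gen[unfolded I]] by blast
    \<comment> \<open>\<open>adj\<close> is reflexive and \<open>E\<close> has no loops, hence the
      restriction to distinct positions.\<close>
    have adj_iff: "adj (os ! a) (os ! b) \<longleftrightarrow> {os ! a, os ! b} \<in> E"
      if "a \<noteq> b" "a < length os" "b < length os" for a b
      using that os by (auto simp: adj_def nth_eq_iff_index_eq)
    have "perfect_elimination_ordering V E os"
      unfolding perfect_elimination_ordering_iff[OF assms(1) os]
    proof (intro allI impI)
      fix i b c
      assume *: "i < b \<and> i < c \<and> b < length os \<and> c < length os \<and> b \<noteq> c \<and>
        {os ! i, os ! b} \<in> E \<and> {os ! i, os ! c} \<in> E"
      then have "adj (os ! b) (os ! c)"
        using adj_iff[of i b] adj_iff[of i c] by (intro pe[of i b c]) auto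
      then show "{os ! b, os ! c} \<in> E" using adj_iff[of b c] * by simp
    qed
    moreover have "{os ! j, os ! l} \<in> E"
      if *: "i < j \<and> j < k \<and> k < l \<and> l < length os \<and>
        {os ! i, os ! k} \<in> E \<and> {os ! i, os ! l} \<in> E \<and> {os ! j, os ! k} \<in> E" for i j k l
    proof -
      have "adj (os ! j) (os ! l)"
        using * adj_iff[of i k] adj_iff[of i l] adj_iff[of j k] by (intro strong[of i j k l]) auto
      then show ?thesis using adj_iff[of j l] * by simp
    qed
    ultimately show ?thesis
      unfolding strongly_chordal_def strong_perfect_elimination_ordering_def by blast
  qed
  ultimately show ?thesis
    unfolding m_def by blast
qed

end
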